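(* Suppose that every contact configuration of $23$ directions $w_1,\dots,w_{23}$ with bounded cell satisfies $$\sum_{i<j}\omega(\gamma_{ij})\ \ge\ 8-A_*=0.092855570\ldots,\qquad(\ast)$$ where $\gamma_{ij}$ is the angle between $w_i$ and $w_j$; equivalently, that the cell of every such configuration has volume at least $8$ inside the ball of radius $\sqrt{3/2}$ about the origin. Then every such configuration has $\mathrm{vol}(V_c)\ge8$, with strict inequality wherever $(\ast)$ is strict, and it follows that every contact configuration of $23$ directions with bounded cell has $\mathrm{vol}(V_c)>8$. The same conclusion follows if every such configuration satisfies the three-point inequality $$\sum_{i<j}\omega_4(\gamma_{ij})-\sum_{i<j<k}\omega_3(\gamma_{ij},\gamma_{ik},\gamma_{jk})\ \ge\ 8-A_4=0.352442\ldots.$$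
   Context: A contact configuration is a finite set $W\subset S^3\subset\mathbb{R}^4$ of unit vectors with $\langle w,w'\rangle\le\frac12$ for all distinct $w,w'\in W$; its cell is $V_c=\{x\in\mathbb{R}^4:\langle x,w\rangle\le1\ \forall w\in W\}$. Measure on $S^3$ is surface measure (total mass $2\pi^2$). A cap of radius $r$ has measure $C(r)=\pi(2r-\sin2r)$; $\Lambda(r,\gamma)$ is the measure of the intersection of two caps of radius $r$ with centres at angle $\gamma$, and $\Lambda_3(r;\gamma,\gamma',\gamma'')$ that of three caps of radius $r$ with centres at the given pairwise angles. Put $r_*=\arcsin(1/\sqrt3)$, $r_4=\arcsin\sqrt{3/8}$, and $$A_*=\tfrac14\Bigl[2\pi^2+\int_0^{r_*}(2\pi^2-23C(r))\,d(\sec^4r)\Bigr]=7.907144430\ldots,\quad \omega(\gamma)=\tfrac14\int_0^{r_*}\Lambda(r,\gamma)\,d(\sec^4r),$$ $$A_4=\tfrac14\Bigl[2\pi^2+\int_0^{r_4}(2\pi^2-23C(r))\,d(\sec^4r)\Bigr],\quad \omega_4(\gamma)=\tfrac14\int_0^{r_4}\Lambda(r,\gamma)\,d(\sec^4r),$$ $$\omega_3(\gamma,\gamma',\gamma'')=\tfrac14\int_0^{r_4}\Lambda_3(r;\gamma,\gamma',\gamma'')\,d(\sec^4r).$$ *)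

theory Defs
  imports "HOL-Analysis.Analysis"
begin

definition contact_config :: "(real^4) set \<Rightarrow> bool" where
  "contact_config W \<longleftrightarrow> finite W \<and> W \<subseteq> sphere 0 1 \<and>
     (\<forall>w\<in>W. \<forall>w'\<in>W. w \<noteq> w' \<longrightarrow> w \<bullet> w' \<le> 1 / 2)"

definition cell :: "(real^4) set \<Rightarrow> (real^4) set" where
  "cell W = {x. \<forall>w\<in>W. x \<bullet> w \<le> 1}"

definition config23 :: "(nat \<Rightarrow> real^4) \<Rightarrow> bool" where
  "config23 w \<longleftrightarrow> inj_on w {1..23} \<and> contact_config (w ` {1..23}) \<and> bounded (cell (w ` {1..23}))"

(* The angle between two unit vectors; it is only applied to unit vectors. *)
definition angle :: "real^4 \<Rightarrow> real^4 \<Rightarrow> real" where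
  "angle u v = arccos (u \<bullet> v)"

(* Surface measure on the unit 3-sphere in polar form: the measure of A is 4 times the volume of
   the cone over A inside the unit ball, as |B| = |S| / 4 in dimension 4. Here sgn x = x / |x|. *)
definition sphere_measure :: "(real^4) measure" where
  "sphere_measure = scale_measure 4
     (distr (restrict_space lborel (cball 0 1 - {0})) (restrict_space borel (sphere 0 1)) sgn)"

lemma space_sphere_measure: "space sphere_measure = sphere 0 1"
  by (simp add: sphere_measure_def space_scale_measure space_restrict_space)

lemma sgn_measurable_punctured_ball:
  "sgn \<in> measurable (restrict_space lborel (cball 0 1 - {0})) (restrict_space borel (sphere 0 (1::real)) :: (real^4) measure)"
proof (rule measurable_restrict_space2)
  show "sgn \<in> space (restrict_space lborel (cball 0 1 - {0})) \<rightarrow> sphere 0 (1::real)"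
    by (auto simp: space_restrict_space norm_sgn)
  show "(sgn :: real^4 \<Rightarrow> _) \<in> borel_measurable (restrict_space lborel (cball 0 1 - {0}))"
    unfolding sgn_div_norm by (rule measurable_restrict_space1) measurable
qed

lemma emeasure_sphere_measure:
  assumes "A \<in> sets borel" "A \<subseteq> sphere 0 1"
  shows "emeasure sphere_measure A = 4 * emeasure lborel {x :: real^4. x \<noteq> 0 \<and> norm x \<le> 1 \<and> sgn x \<in> A}"
proof -
  have "A \<in> sets (restrict_space borel (sphere 0 1))"
    using assms by (auto simp: sets_restrict_space_iff)
  moreover have "sgn -` A \<inter> space (restrict_space lborel (cball 0 1 - {0})) =
      {x :: real^4. x \<noteq> 0 \<and> norm x \<le> 1 \<and> sgn x \<in> A}"
    by (auto simp: space_restrict_space)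
  ultimately show ?thesis
    using sgn_measurable_punctured_ball
    by (simp add: sphere_measure_def emeasure_distr)
       (subst emeasure_restrict_space, auto)
qed

lemma measure_sphere_measure_total: "measure sphere_measure (sphere 0 1) = 2 * pi\<^sup>2"
proof -
  have "{x :: real^4. x \<noteq> 0 \<and> norm x \<le> 1 \<and> sgn x \<in> sphere 0 1} = cball 0 1 - {0}"
    by (auto simp: norm_sgn)
  then have "emeasure sphere_measure (sphere 0 1) = 4 * emeasure lborel (cball (0::real^4) 1 - {0})"
    by (subst emeasure_sphere_measure) auto
  also have "emeasure lborel (cball (0::real^4) 1 - {0}) = emeasure lborel (cball (0::real^4) 1)"
    by (rule emeasure_Diff_null_set) auto
  also have "\<dots> = ennreal (pi\<^sup>2 / 2)"
    by (simp add: emeasure_cball eval_unit_ball_vol)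
  finally have "emeasure sphere_measure (sphere 0 1) = ennreal 4 * ennreal (pi\<^sup>2 / 2)"
    by simp
  also have "\<dots> = ennreal (2 * pi\<^sup>2)"
    by (subst ennreal_mult[symmetric]) auto
  finally show ?thesis by (simp add: measure_def)
qed

definition cap :: "real^4 \<Rightarrow> real \<Rightarrow> (real^4) set" where
  "cap c r = {u \<in> sphere 0 1. angle u c \<le> r}"

(* The measure of a cap of radius r, 0 \<le> r \<le> pi. *)
definition C :: "real \<Rightarrow> real" where
  "C r = pi * (2 * r - sin (2 * r))"

(* By rotation invariance the measure below depends on the angles only, not on the centres;
   the definite description is junk if no centres have the prescribed angles. *)
definition Lam :: "real \<Rightarrow> real \<Rightarrow> real" where
  "Lam r \<gamma> = (THE m. \<exists>u\<in>sphere 0 1. \<exists>v\<in>sphere 0 1. angle u v = \<gamma> \<and>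
     m = measure sphere_measure (cap u r \<inter> cap v r))"

definition Lam3 :: "real \<Rightarrow> real \<Rightarrow> real \<Rightarrow> real \<Rightarrow> real" where
  "Lam3 r \<gamma> \<gamma>' \<gamma>'' = (THE m. \<exists>u\<in>sphere 0 1. \<exists>v\<in>sphere 0 1. \<exists>t\<in>sphere 0 1.
     angle u v = \<gamma> \<and> angle u t = \<gamma>' \<and> angle v t = \<gamma>'' \<and>
     m = measure sphere_measure (cap u r \<inter> cap v r \<inter> cap t r))"

definition r_star :: real where "r_star = arcsin (1 / sqrt 3)"
definition r_4 :: real where "r_4 = arcsin (sqrt (3 / 8))"

(* The integral of f(r) d(sec^4 r) over [0, R], where 0 \<le> R < pi/2. *)
definition sec4_integral :: "real \<Rightarrow> (real \<Rightarrow> real) \<Rightarrow> real" where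
  "sec4_integral R f = integral {0..R} (\<lambda>r. f r * deriv (\<lambda>s. 1 / cos s ^ 4) r)"

definition A_star :: real where
  "A_star = 1 / 4 * (2 * pi\<^sup>2 + sec4_integral r_star (\<lambda>r. 2 * pi\<^sup>2 - 23 * C r))"

definition A_4 :: real where
  "A_4 = 1 / 4 * (2 * pi\<^sup>2 + sec4_integral r_4 (\<lambda>r. 2 * pi\<^sup>2 - 23 * C r))"

definition omega :: "real \<Rightarrow> real" where
  "omega \<gamma> = 1 / 4 * sec4_integral r_star (\<lambda>r. Lam r \<gamma>)"

definition omega_4 :: "real \<Rightarrow> real" where
  "omega_4 \<gamma> = 1 / 4 * sec4_integral r_4 (\<lambda>r. Lam r \<gamma>)"

definition omega_3 :: "real \<Rightarrow> real \<Rightarrow> real \<Rightarrow> real" where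
  "omega_3 \<gamma> \<gamma>' \<gamma>'' = 1 / 4 * sec4_integral r_4 (\<lambda>r. Lam3 r \<gamma> \<gamma>' \<gamma>'')"

definition pair_sum :: "(real \<Rightarrow> real) \<Rightarrow> (nat \<Rightarrow> real^4) \<Rightarrow> real" where
  "pair_sum g w = (\<Sum>j=1..23. \<Sum>i=1..<j. g (angle (w i) (w j)))"

definition triple_sum :: "(real \<Rightarrow> real \<Rightarrow> real \<Rightarrow> real) \<Rightarrow> (nat \<Rightarrow> real^4) \<Rightarrow> real" where
  "triple_sum g w = (\<Sum>k=1..23. \<Sum>j=1..<k. \<Sum>i=1..<j.
     g (angle (w i) (w j)) (angle (w i) (w k)) (angle (w j) (w k)))"

definition vol :: "(real^4) set \<Rightarrow> real" where
  "vol S = measure lborel S"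

end

theory Submission
  imports Defs
begin

text \<open>
  The part of the cell at distance more than \<open>sec r\<close> from the origin lies over directions that no
  cap of radius \<open>r\<close> covers, so the volume of the cell inside the ball of radius \<open>sec R\<close> is
  \<open>1/4\<close> times \<open>2 \<pi>\<^sup>2\<close> plus the integral of the uncovered measure against \<open>d(sec\<^sup>4 r)\<close> over
  \<open>[0, R]\<close>. Three directions with pairwise inner products at most \<open>1/2\<close> sum to a vector of squared
  norm at most \<open>6\<close>, and four to one of squared norm at most \<open>10\<close>; hence no three caps meet for
  \<open>r < r_star\<close> and no four for \<open>r < r_4\<close>. Truncated inclusion-exclusion then turns the
  integral into the pair and triple sums.

  Strictness: a farthest point of a bounded cell is at least \<open>sqrt (8/5)\<close> away from the origin. If no
  point were farther, four tight directions at it would span a regular simplex of edge \<open>\<pi> / 3\<close>, and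
  the cell would continue around every edge by reflections with dihedral angle \<open>arccos (1/4)\<close>,
  which does not divide \<open>2 \<pi>\<close>.
\<close>

subsection \<open>The cell sticks out of the ball\<close>

text \<open>The hypotheses control the cell only inside a ball, so strictness has to come from
  volume outside it. For the radius sqrt (3/2) any farthest point would do, but the three-point
  bound uses 1 / cos \<open>r_4\<close> = sqrt (8/5), exactly the lower bound for the distance of a
  farthest point: both numbers come from the same estimate for the sum of four directions. Hence the
  case of a cell contained in that closed ball must be excluded outright. The growth rate of the
  truncated volume is found by squeezing its increments between two conical shells and
  differentiating, so that continuity of the uncovered measure in the radius replaces an integral in
  polar coordinates. \<open>Lam\<close> and \<open>Lam3\<close> are definite descriptions over all
  centres with the given angles, which makes rotation invariance an obligation: families with equal
  Gram matrices are matched by products of reflections. The numerical claims rest on closed forms in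
  which each arctangent has a rational multiple of a square root as argument, so that its series
  reduces to rational arithmetic.\<close>

lemma closed_cell: "closed (cell W)"
proof -
  have "cell W = (\<Inter>w\<in>W. {x. w \<bullet> x \<le> 1})"
    by (auto simp: cell_def inner_commute)
  then show ?thesis by (auto intro: closed_halfspace_le)
qed

lemma convex_cell: "convex (cell W)"
proof -
  have "cell W = (\<Inter>w\<in>W. {x. w \<bullet> x \<le> 1})"
    by (auto simp: cell_def inner_commute)
  then show ?thesis by (auto intro: convex_INT convex_halfspace_le)
qed

lemma cball_subset_cell:
  assumes "W \<subseteq> sphere 0 1"
  shows "cball 0 1 \<subseteq> cell W"
proof
  fix x :: "real^4" assume x: "x \<in> cball 0 1"
  have "x \<bullet> w \<le> 1" if "w \<in> W" for w
  proof -
    have "x \<bullet> w \<le> norm x * norm w" by (rule norm_cauchy_schwarz)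
    also have "\<dots> \<le> 1" using x that assms by auto
    finally show ?thesis .
  qed
  then show "x \<in> cell W" by (simp add: cell_def)
qed

text \<open>A feasible-direction test: tight constraints do not increase along \<open>d\<close>, and
  the finitely many slack ones stay slack for small \<open>e > 0\<close>.\<close>

lemma eventually_in_cell:
  assumes "finite W" "x \<in> cell W" and d: "\<And>w. w \<in> W \<Longrightarrow> x \<bullet> w = 1 \<Longrightarrow> d \<bullet> w \<le> 0"
  shows "\<forall>\<^sub>F e in at_right (0::real). x + e *\<^sub>R d \<in> cell W"
proof -
  have "\<forall>\<^sub>F e in at_right (0::real). (x + e *\<^sub>R d) \<bullet> w \<le> 1" if w: "w \<in> W" for w
  proof (cases "x \<bullet> w = 1")
    case True
    have "\<forall>\<^sub>F e in at_right (0::real). e > 0" by (rule eventually_at_right_less)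
    then show ?thesis
    proof eventually_elim
      case (elim e)
      then show ?case using d[OF w True] True
        by (simp add: inner_add_left mult_nonneg_nonpos)
    qed
  next
    case False
    then have lt: "x \<bullet> w < 1" using assms(2) w by (force simp: cell_def)
    have "((\<lambda>e. (x + e *\<^sub>R d) \<bullet> w) \<longlongrightarrow> (x + 0 *\<^sub>R d) \<bullet> w) (at_right 0)"
      by (intro tendsto_intros)
    then have "\<forall>\<^sub>F e in at_right (0::real). (x + e *\<^sub>R d) \<bullet> w < 1"
      using lt by (intro order_tendstoD(2)[where y="x \<bullet> w"]) auto
    then show ?thesis by eventually_elim simp
  qed
  then have "\<forall>\<^sub>F e in at_right (0::real). \<forall>w\<in>W. (x + e *\<^sub>R d) \<bullet> w \<le> 1"
    using assms(1) by (simp add: eventually_ball_finite)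
  then show ?thesis by (simp add: cell_def)
qed

text \<open>At a farthest point \<open>x\<close>, a nonzero \<open>d\<close> orthogonal to all tight
  directions would keep both x + e d and x - e d in the cell. Their squared norms add up to twice
  that of \<open>x\<close> plus 2 e^2 |d|^2, so one of them would be farther away. Spanning then
  supplies at least four tight directions.\<close>

lemma farthest_point_tight:
  assumes "finite W" "W \<subseteq> sphere 0 1" "bounded (cell W)"
  obtains x where "x \<in> cell W" "span {w \<in> W. x \<bullet> w = 1} = UNIV"
proof -
  have "compact (cell W)" using assms closed_cell by (simp add: compact_eq_bounded_closed)
  moreover have "cell W \<noteq> {}" using cball_subset_cell[OF assms(2)] by auto
  ultimately have "\<exists>x\<in>cell W. \<forall>y\<in>cell W. norm y \<le> norm x"
    by (intro continuous_attains_sup continuous_on_norm_id)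
  then obtain x where x: "x \<in> cell W" and mx: "\<And>y. y \<in> cell W \<Longrightarrow> norm y \<le> norm x"
    by blast
  have "span {w \<in> W. x \<bullet> w = 1} = UNIV"
  proof (rule ccontr)
    assume "span {w \<in> W. x \<bullet> w = 1} \<noteq> UNIV"
    from span_not_UNIV_orthogonal[OF this]
    obtain d where d0: "d \<noteq> 0" and d: "\<And>w. w \<in> span {w \<in> W. x \<bullet> w = 1} \<Longrightarrow> d \<bullet> w = 0"
      by blast
    have d': "d \<bullet> w = 0" if "w \<in> W" "x \<bullet> w = 1" for w
      using that by (intro d span_base) auto
    have "\<forall>\<^sub>F e in at_right (0::real). x + e *\<^sub>R d \<in> cell W"
      using assms(1) x by (rule eventually_in_cell) (simp add: d')
    moreover have "\<forall>\<^sub>F e in at_right (0::real). x + e *\<^sub>R (- d) \<in> cell W"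
      using assms(1) x by (rule eventually_in_cell) (simp add: d')
    moreover have "\<forall>\<^sub>F e in at_right (0::real). e > 0" by (rule eventually_at_right_less)
    ultimately have "\<forall>\<^sub>F e in at_right (0::real). x + e *\<^sub>R d \<in> cell W \<and> x + e *\<^sub>R (- d) \<in> cell W \<and> e > 0"
      by eventually_elim auto
    then obtain e where e: "x + e *\<^sub>R d \<in> cell W" "x + e *\<^sub>R (- d) \<in> cell W" "e > 0"
      using eventually_happens'[OF trivial_limit_at_right_real] by blast
    have "(norm (x + e *\<^sub>R d))\<^sup>2 \<le> (norm x)\<^sup>2" "(norm (x + e *\<^sub>R (- d)))\<^sup>2 \<le> (norm x)\<^sup>2"
      using mx[OF e(1)] mx[OF e(2)] by (simp_all add: power_mono)
    then have "e\<^sup>2 * (d \<bullet> d) \<le> 0"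
      unfolding power2_norm_eq_inner
      by (simp add: inner_add_left inner_add_right inner_diff_left inner_diff_right inner_commute power2_eq_square)
    then have "d \<bullet> d \<le> 0" using e(3) by (simp add: mult_le_0_iff)
    then show False using d0 by (metis inner_gt_zero_iff not_less)
  qed
  then show ?thesis using that x by blast
qed

lemma inner_le_half:
  assumes "contact_config W" "a \<in> W" "b \<in> W" "a \<noteq> b"
  shows "a \<bullet> b \<le> 1 / 2"
  using assms unfolding contact_config_def by blast

lemma inner_self_one:
  assumes "contact_config W" "a \<in> W"
  shows "a \<bullet> a = 1"
proof -
  have "norm a = 1" using assms by (auto simp: contact_config_def)
  then show ?thesis by (simp add: norm_eq_1)
qed

text \<open>Four squares equal to 1 and six cross terms of at most 1 each. The bound serves twice: 4
  / sqrt 10 = sqrt (8/5) bounds the norm of a point tight at four directions from below, and sqrt 10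
  / 4 = cos \<open>r_4\<close> is the threshold for four caps to meet.\<close>

lemma norm_sum_four_le:
  assumes W: "contact_config W" and abcd: "a \<in> W" "b \<in> W" "c \<in> W" "d \<in> W" "distinct [a, b, c, d]"
  shows "(norm (a + b + c + d))\<^sup>2 \<le> 10"
proof -
  note le = inner_le_half[OF W]
  have half: "a \<bullet> b \<le> 1 / 2" "a \<bullet> c \<le> 1 / 2" "a \<bullet> d \<le> 1 / 2" "b \<bullet> c \<le> 1 / 2" "b \<bullet> d \<le> 1 / 2" "c \<bullet> d \<le> 1 / 2"
    using le[of a b] le[of a c] le[of a d] le[of b c] le[of b d] le[of c d] abcd by simp_all
  have self: "a \<bullet> a = 1" "b \<bullet> b = 1" "c \<bullet> c = 1" "d \<bullet> d = 1"
    using inner_self_one[OF W] abcd by auto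
  have "(norm (a + b + c + d))\<^sup>2 = 4 + 2 * (a \<bullet> b + a \<bullet> c + a \<bullet> d + b \<bullet> c + b \<bullet> d + c \<bullet> d)"
    unfolding power2_norm_eq_inner
    by (simp add: inner_add_left inner_add_right self inner_commute[of b a] inner_commute[of c a]
        inner_commute[of c b] inner_commute[of d a] inner_commute[of d b] inner_commute[of d c])
  also have "\<dots> \<le> 4 + 2 * (1 / 2 + 1 / 2 + 1 / 2 + 1 / 2 + 1 / 2 + 1 / 2)"
    by (intro add_mono mult_left_mono half order_refl) simp
  finally show ?thesis by simp
qed

text \<open>The inequality \<open>4 = y \<bullet> (a + b + c + d) \<le> norm y * sqrt 10\<close> is an equality here.\<close>

lemma vertex_eq:
  assumes W: "contact_config W" and abcd: "a \<in> W" "b \<in> W" "c \<in> W" "d \<in> W" "distinct [a, b, c, d]"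
    and y: "norm y \<le> sqrt (8 / 5)" "y \<bullet> a = 1" "y \<bullet> b = 1" "y \<bullet> c = 1" "y \<bullet> d = 1"
  shows "y = (2 / 5) *\<^sub>R (a + b + c + d)"
proof -
  define S where "S = a + b + c + d"
  have SS: "S \<bullet> S \<le> 10"
    using norm_sum_four_le[OF W abcd] by (simp add: S_def power2_norm_eq_inner)
  have yy: "y \<bullet> y \<le> 8 / 5"
  proof -
    have "(norm y)\<^sup>2 \<le> (sqrt (8 / 5))\<^sup>2" using y(1) by (intro power_mono) auto
    then show ?thesis by (simp add: power2_norm_eq_inner)
  qed
  have yS: "y \<bullet> S = 4"
    using y by (simp add: S_def inner_add_right)
  \<comment> \<open>In the equality case of Cauchy-Schwarz \<open>y\<close> is the multiple 4 / 10
    of \<open>S\<close>; expanding the distance to that multiple gives at most 8/5 - 16/5 + 8/5 =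
    0.\<close>
  have "(norm (y - (2 / 5) *\<^sub>R S))\<^sup>2 = y \<bullet> y - 4 / 5 * (y \<bullet> S) + 4 / 25 * (S \<bullet> S)"
    unfolding power2_norm_eq_inner
    by (simp add: inner_diff_left inner_diff_right inner_commute[of S y] diff_divide_distrib)
  also have "\<dots> \<le> 0" using SS yy yS by simp
  finally have "y = (2 / 5) *\<^sub>R S" by simp
  then show ?thesis by (simp add: S_def)
qed

text \<open>For unit vectors pairwise at angle pi / 3, the point in the last clause is the only one
  having inner product 1 with all four, and its norm is sqrt (8/5). Its membership in the cell
  therefore says that it is a vertex of the cell at the extremal distance.\<close>

definition regular_vertex :: "(real^4) set \<Rightarrow> real^4 \<Rightarrow> real^4 \<Rightarrow> real^4 \<Rightarrow> real^4 \<Rightarrow> bool" where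
  "regular_vertex W a b c d \<longleftrightarrow> {a, b, c, d} \<subseteq> W \<and>
     a \<bullet> b = 1 / 2 \<and> a \<bullet> c = 1 / 2 \<and> a \<bullet> d = 1 / 2 \<and> b \<bullet> c = 1 / 2 \<and> b \<bullet> d = 1 / 2 \<and> c \<bullet> d = 1 / 2 \<and>
     (2 / 5) *\<^sub>R (a + b + c + d) \<in> cell W"

text \<open>Following the edge of the cell opposite to \<open>d\<close> leads to the next vertex, whose new
  direction is the mirror image of \<open>d\<close> in the span of \<open>a\<close>, \<open>b\<close>, \<open>c\<close>.\<close>

lemma regular_vertex_neighbour:
  assumes W: "contact_config W" and bd: "cell W \<subseteq> cball 0 (sqrt (8 / 5))"
    and v: "regular_vertex W a b c d"
  shows "regular_vertex W a b c ((1 / 2) *\<^sub>R (a + b + c) - d)"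
proof -
  define x where "x = (2 / 5) *\<^sub>R (a + b + c + d)"
  \<comment> \<open>The orthogonal projection of \<open>d\<close> to the span of \<open>a\<close>,
    \<open>b\<close>, \<open>c\<close> is one quarter of their sum. So \<open>h\<close> points from
    \<open>d\<close> to its projection, d + 2 h is the mirror image, and \<open>h\<close> runs along
    the edge on which \<open>a\<close>, \<open>b\<close>, \<open>c\<close> stay tight.\<close>
  define h where "h = (1 / 4) *\<^sub>R (a + b + c) - d"
  have fin: "finite W" using W by (simp add: contact_config_def)
  have mem: "a \<in> W" "b \<in> W" "c \<in> W" "d \<in> W" and xc: "x \<in> cell W"
    using v by (auto simp: regular_vertex_def x_def)
  have self: "a \<bullet> a = 1" "b \<bullet> b = 1" "c \<bullet> c = 1" "d \<bullet> d = 1"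
    using inner_self_one[OF W] mem by auto
  have half: "a \<bullet> b = 1 / 2" "a \<bullet> c = 1 / 2" "a \<bullet> d = 1 / 2" "b \<bullet> c = 1 / 2" "b \<bullet> d = 1 / 2" "c \<bullet> d = 1 / 2"
    "b \<bullet> a = 1 / 2" "c \<bullet> a = 1 / 2" "d \<bullet> a = 1 / 2" "c \<bullet> b = 1 / 2" "d \<bullet> b = 1 / 2" "d \<bullet> c = 1 / 2"
    using v by (auto simp: regular_vertex_def inner_commute)
  have dist: "distinct [a, b, c]" using self half by auto
  have xi: "x \<bullet> a = 1" "x \<bullet> b = 1" "x \<bullet> c = 1" "x \<bullet> d = 1"
    by (simp_all add: x_def inner_add_left self half)
  have hi: "h \<bullet> a = 0" "h \<bullet> b = 0" "h \<bullet> c = 0" "h \<bullet> d = - 5 / 8" "h \<bullet> h = 5 / 8"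
    by (simp_all add: h_def inner_add_left inner_diff_left inner_add_right inner_diff_right self half)
  \<comment> \<open>Any other direction of \<open>W\<close> has inner product at most 1/2 with each
    of the four, hence at most 4/5 with \<open>x\<close>.\<close>
  have tight: "w \<in> {a, b, c, d}" if "w \<in> W" "x \<bullet> w = 1" for w
  proof (rule ccontr)
    assume "w \<notin> {a, b, c, d}"
    then have "a \<bullet> w \<le> 1 / 2" "b \<bullet> w \<le> 1 / 2" "c \<bullet> w \<le> 1 / 2" "d \<bullet> w \<le> 1 / 2"
      using inner_le_half[OF W] mem that by auto
    then show False using that by (simp add: x_def inner_add_left)
  qed
  have ev: "\<forall>\<^sub>F e in at_right (0::real). x + e *\<^sub>R h \<in> cell W"
    proof (rule eventually_in_cell[OF fin xc])
    fix w assume "w \<in> W" "x \<bullet> w = 1"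
    then have "w \<in> {a, b, c, d}" by (rule tight)
    then show "h \<bullet> w \<le> 0" using hi by auto
  qed
  moreover have "\<forall>\<^sub>F e in at_right (0::real). e > 0" by (rule eventually_at_right_less)
  ultimately have "\<forall>\<^sub>F e in at_right (0::real). x + e *\<^sub>R h \<in> cell W \<and> e > 0"
    by eventually_elim auto
  then obtain e where e: "x + e *\<^sub>R h \<in> cell W" "e > 0"
    using eventually_happens'[OF trivial_limit_at_right_real] by blast
  \<comment> \<open>The parameters of the line through \<open>x\<close> along \<open>h\<close> that
    stay in the cell; the maximum of \<open>T\<close> is the far end of the edge.\<close>
  define T where "T = {t. x + t *\<^sub>R h \<in> cell W}"
  have "compact T"
  proof -
    have "closed T"
    proof -
      have "T = (\<lambda>t. x + t *\<^sub>R h) -` cell W" by (auto simp: T_def)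
      then show ?thesis using closed_cell by (simp add: continuous_closed_vimage)
    qed
    moreover have "bounded T"
    proof -
      have "norm t \<le> 2 * sqrt (8 / 5) / norm h" if "t \<in> T" for t
      proof -
        have "norm (t *\<^sub>R h) \<le> norm (x + t *\<^sub>R h) + norm x"
          using norm_triangle_ineq4[of "x + t *\<^sub>R h" x] by simp
        also have "norm (x + t *\<^sub>R h) \<le> sqrt (8 / 5)" using subsetD[OF bd] that by (simp add: T_def)
        also have "norm x \<le> sqrt (8 / 5)" using subsetD[OF bd xc] by simp
        finally have "\<bar>t\<bar> * norm h \<le> 2 * sqrt (8 / 5)" by simp
        moreover have "norm h > 0" using hi(5) by auto
        ultimately show ?thesis by (simp add: field_simps)
      qed
      then show ?thesis by (auto simp: bounded_iff)
    qed
    ultimately show ?thesis by (simp add: compact_eq_bounded_closed)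
  qed
  moreover have "T \<noteq> {}" using e by (auto simp: T_def)
  ultimately have "\<exists>t\<in>T. \<forall>s\<in>T. s \<le> t" by (rule compact_attains_sup)
  then obtain t where t: "t \<in> T" "\<And>s. s \<in> T \<Longrightarrow> s \<le> t" by blast
  have tpos: "t > 0" using t(2)[of e] e by (simp add: T_def)
  define y where "y = x + t *\<^sub>R h"
  have yc: "y \<in> cell W" using t(1) by (simp add: T_def y_def)
  \<comment> \<open>Some constraint must block the way at the far end, since otherwise
    \<open>T\<close> would contain parameters beyond its maximum. As \<open>h\<close> is orthogonal
    to \<open>a\<close>, \<open>b\<close>, \<open>c\<close>, the blocking direction is a new
    one.\<close>
  obtain w where w: "w \<in> W" "y \<bullet> w = 1" "h \<bullet> w > 0"
  proof (rule ccontr)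
    assume "\<not> thesis"
    with that have "\<And>w. w \<in> W \<Longrightarrow> y \<bullet> w = 1 \<Longrightarrow> h \<bullet> w \<le> 0" by force
    then have "\<forall>\<^sub>F e in at_right (0::real). y + e *\<^sub>R h \<in> cell W"
      by (rule eventually_in_cell[OF fin yc])
    moreover have "\<forall>\<^sub>F e in at_right (0::real). e > 0" by (rule eventually_at_right_less)
    ultimately have "\<forall>\<^sub>F e in at_right (0::real). y + e *\<^sub>R h \<in> cell W \<and> e > 0"
      by eventually_elim auto
    then obtain e where "y + e *\<^sub>R h \<in> cell W" "e > 0"
      using eventually_happens'[OF trivial_limit_at_right_real] by blast
    then show False using t(2)[of "t + e"] by (simp add: T_def y_def algebra_simps)
  qed
  have yi: "y \<bullet> a = 1" "y \<bullet> b = 1" "y \<bullet> c = 1"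
    by (simp_all add: y_def inner_add_left xi hi)
  have "distinct [a, b, c, w]" using dist w(3) hi by auto
  \<comment> \<open>The far end is again tight at four distinct directions and lies in the ball, so
    it is the extremal vertex over them. Comparison with x + t h puts \<open>w\<close> on the line
    through \<open>d\<close> along \<open>h\<close>.\<close>
  then have y2: "y = (2 / 5) *\<^sub>R (a + b + c + w)"
    using W mem w yi yc bd by (intro vertex_eq) auto
  define s where "s = 5 / 2 * t"
  have ws: "w = d + s *\<^sub>R h"
  proof -
    have "(2 / 5) *\<^sub>R w = (2 / 5) *\<^sub>R d + t *\<^sub>R h"
      using y2 unfolding y_def x_def by (simp add: algebra_simps)
    then have "(5 / 2) *\<^sub>R (2 / 5) *\<^sub>R w = (5 / 2) *\<^sub>R ((2 / 5) *\<^sub>R d + t *\<^sub>R h)" by simp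
    then show ?thesis by (simp add: s_def algebra_simps)
  qed
  \<comment> \<open>Since d . h = -5/8 and h . h = 5/8, unit length of \<open>w\<close> reads s^2 =
    2 s; the root s = 0 is excluded by t > 0.\<close>
  have "w \<bullet> w = 1" using inner_self_one[OF W w(1)] .
  then have "s * s - 2 * s = 0"
    unfolding ws using hi by (simp add: inner_add_left inner_add_right self inner_commute)
  then have "s * (s - 2) = 0" by (simp add: algebra_simps)
  then have "s = 2" using tpos by (simp add: s_def)
  then have we: "w = (1 / 2) *\<^sub>R (a + b + c) - d"
    unfolding ws h_def by (simp add: algebra_simps scaleR_2)
  have "a \<bullet> w = 1 / 2" "b \<bullet> w = 1 / 2" "c \<bullet> w = 1 / 2"
    unfolding we by (simp_all add: inner_add_right inner_diff_right self half)
  then show ?thesis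
    unfolding we[symmetric] regular_vertex_def using mem w half yc y2 by simp
qed

lemma regular_vertex_commute:
  assumes "regular_vertex W a b c d"
  shows "regular_vertex W a b d c"
proof -
  have "a + b + d + c = a + b + c + d" by simp
  show ?thesis using assms unfolding regular_vertex_def \<open>a + b + d + c = _\<close> inner_commute[of d c] by blast
qed

text \<open>Three reflections around the edge \<open>a\<close>, \<open>b\<close> lead to a direction at angle less than
  \<open>\<pi> / 3\<close> from the first one: \<open>arccos (1 / 4)\<close> times four is about \<open>302\<close> degrees.\<close>

lemma not_regular_vertex:
  assumes W: "contact_config W" and bd: "cell W \<subseteq> cball 0 (sqrt (8 / 5))"
  shows "\<not> regular_vertex W a b d c"
proof
  assume v: "regular_vertex W a b d c"
  \<comment> \<open>In the sequence \<open>c\<close>, \<open>d\<close>, \<open>z2\<close>,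
    \<open>z3\<close>, \<open>z4\<close> each term is the reflection of the term two places before
    it, a turn by arccos (1/4) about the plane of \<open>a\<close> and \<open>b\<close>. The inner
    products with \<open>c\<close> are 1, 1/2, -1/4, -1/8, 11/16, and the last one is forbidden.
    Swapping the last two arguments of \<open>regular_vertex\<close> puts the older direction in the
    place that is reflected next.\<close>
  define z2 where "z2 = (1 / 2) *\<^sub>R (a + b + d) - c"
  define z3 where "z3 = (1 / 2) *\<^sub>R (a + b + z2) - d"
  define z4 where "z4 = (1 / 2) *\<^sub>R (a + b + z3) - z2"
  note nb = regular_vertex_neighbour[OF W bd]
  have "regular_vertex W a b d z2" unfolding z2_def by (rule nb[OF v])
  then have "regular_vertex W a b z2 z3" unfolding z3_def by (rule nb[OF regular_vertex_commute])
  then have "regular_vertex W a b z3 z4" unfolding z4_def by (rule nb[OF regular_vertex_commute])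
  then have z4: "z4 \<in> W" by (simp add: regular_vertex_def)
  have c: "c \<in> W" using v by (simp add: regular_vertex_def)
  have i: "a \<bullet> c = 1 / 2" "b \<bullet> c = 1 / 2" "d \<bullet> c = 1 / 2" using v by (simp_all add: regular_vertex_def)
  have "z2 \<bullet> c = - 1 / 4"
    by (simp add: z2_def inner_add_left inner_diff_left i inner_self_one[OF W c])
  then have "z3 \<bullet> c = - 1 / 8" "z2 \<bullet> c = - 1 / 4"
    by (simp_all add: z3_def inner_add_left inner_diff_left i)
  then have "z4 \<bullet> c = 11 / 16"
    by (simp add: z4_def inner_add_left inner_diff_left i)
  moreover from this have "z4 \<noteq> c" using inner_self_one[OF W c] by auto
  ultimately show False using inner_le_half[OF W z4 c] by simp
qed

text \<open>Containment in the ball turns a farthest point with four tight directions into an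
  extremal vertex, and the tightness equations there force the four directions to be pairwise at
  angle pi / 3.\<close>

lemma cell_not_subset_cball:
  assumes W: "contact_config W" and "bounded (cell W)"
  shows "\<not> cell W \<subseteq> cball 0 (sqrt (8 / 5))"
proof
  assume bd: "cell W \<subseteq> cball 0 (sqrt (8 / 5))"
  have "finite W" "W \<subseteq> sphere 0 1" using W by (auto simp: contact_config_def)
  from farthest_point_tight[OF this assms(2)]
  obtain y where y: "y \<in> cell W" and sp: "span {w \<in> W. y \<bullet> w = 1} = UNIV" .
  let ?T = "{w \<in> W. y \<bullet> w = 1}"
  have fT: "finite ?T" using \<open>finite W\<close> by simp
  have "dim ?T = 4" using sp dim_span[of ?T] by simp
  then have "4 \<le> card ?T" using dim_le_card'[OF fT] by simp
  from obtain_subset_with_card_n[OF this] obtain S where S: "S \<subseteq> ?T" "card S = 4" by blast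
  then obtain a b c d where abcd: "S = {a, b, c, d}" "distinct [a, b, c, d]"
    by (auto simp: card_Suc_eq numeral_eq_Suc)
  have mem: "a \<in> W" "b \<in> W" "c \<in> W" "d \<in> W" using S abcd by auto
  have yi: "y \<bullet> a = 1" "y \<bullet> b = 1" "y \<bullet> c = 1" "y \<bullet> d = 1" using S abcd by auto
  have ye: "y = (2 / 5) *\<^sub>R (a + b + c + d)"
    using W mem abcd(2) yi y bd by (intro vertex_eq) auto
  have self: "a \<bullet> a = 1" "b \<bullet> b = 1" "c \<bullet> c = 1" "d \<bullet> d = 1"
    using inner_self_one[OF W] mem by auto
  have le: "a \<bullet> b \<le> 1 / 2" "a \<bullet> c \<le> 1 / 2" "a \<bullet> d \<le> 1 / 2" "b \<bullet> c \<le> 1 / 2" "b \<bullet> d \<le> 1 / 2" "c \<bullet> d \<le> 1 / 2"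
    using inner_le_half[OF W, of a b] inner_le_half[OF W, of a c] inner_le_half[OF W, of a d]
      inner_le_half[OF W, of b c] inner_le_half[OF W, of b d] inner_le_half[OF W, of c d] mem abcd(2)
    by simp_all
  \<comment> \<open>Each equation has three summands of at most 1/2 and total 3/2, so every summand
    equals 1/2; the three equations together cover all six pairs.\<close>
  have "a \<bullet> b + a \<bullet> c + a \<bullet> d = 3 / 2" "a \<bullet> b + b \<bullet> c + b \<bullet> d = 3 / 2"
    "a \<bullet> c + b \<bullet> c + c \<bullet> d = 3 / 2"
    using yi unfolding ye
    by (simp_all add: inner_add_left self inner_commute[of b a] inner_commute[of c a]
        inner_commute[of c b] inner_commute[of d a] inner_commute[of d b] inner_commute[of d c])
  then have "regular_vertex W a b c d"
    using le mem y ye by (simp add: regular_vertex_def)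
  then show False using not_regular_vertex[OF W bd] by blast
qed

text \<open>A single point outside the ball is enough: the cell is convex, closed and contains the
  unit ball, hence is the closure of its interior, and so a nonempty open part of it lies outside
  the ball.\<close>

lemma vol_truncated_less:
  assumes "contact_config W" "bounded (cell W)" "R \<le> sqrt (8 / 5)"
  shows "vol (cell W \<inter> cball 0 R) < vol (cell W)"
proof -
  let ?V = "cell W"
  have W: "W \<subseteq> sphere 0 1" using assms by (simp add: contact_config_def)
  have "\<not> ?V \<subseteq> cball 0 R" using cell_not_subset_cball[OF assms(1,2)] assms(3) by fastforce
  then obtain x where x: "x \<in> ?V" "x \<in> - cball 0 R" by blast
  have "ball 0 1 \<subseteq> interior ?V"
    using cball_subset_cell[OF W] by (intro interior_maximal) auto
  then have "interior ?V \<noteq> {}" by auto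
  then have "closure (interior ?V) = ?V"
    using convex_closure_interior[OF convex_cell] closed_cell by auto
  moreover have oc: "open (- cball 0 R :: (real^4) set)" by (intro open_Compl closed_cball)
  ultimately have ne: "interior ?V \<inter> - cball 0 R \<noteq> {}"
    using x open_Int_closure_eq_empty[of "- cball 0 R" "interior ?V"] by (auto simp: Int_commute)
  let ?O = "interior ?V \<inter> - cball 0 R"
  have op: "open ?O" using oc by (intro open_Int open_interior)
  have fV: "emeasure lborel ?V < \<infinity>"
    using assms(2) emeasure_bounded_finite by auto
  have fO: "emeasure lborel ?O < \<infinity>"
    by (rule le_less_trans[OF _ fV]) (use interior_subset closed_cell in \<open>auto intro!: emeasure_mono\<close>)
  have fI: "emeasure lborel (?V \<inter> cball 0 R) < \<infinity>"
    by (rule le_less_trans[OF _ fV]) (use closed_cell in \<open>auto intro!: emeasure_mono\<close>)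
  have "measure lborel ?O > 0"
  proof (rule ccontr)
    assume "\<not> 0 < measure lborel ?O"
    then have "measure lborel ?O = 0" using measure_nonneg[of lborel ?O] by linarith
    then have "emeasure lborel ?O = 0" using fO by (simp add: emeasure_eq_ennreal_measure top.not_eq_extremum)
    then have "?O \<in> null_sets lborel" using op by auto
    then have "negligible ?O" by (simp add: negligible_iff_null_sets null_sets_completionI)
    then show False using open_not_negligible[OF op ne] by simp
  qed
  moreover have "measure lborel (?V \<inter> cball 0 R \<union> ?O) = measure lborel (?V \<inter> cball 0 R) + measure lborel ?O"
    using fI fO op closed_cell by (intro measure_Union) auto
  moreover have "measure lborel (?V \<inter> cball 0 R \<union> ?O) \<le> measure lborel ?V"
    using interior_subset fV closed_cell op
    by (intro measure_mono_fmeasurable) (auto simp: fmeasurable_def)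
  ultimately show ?thesis by (simp add: vol_def)
qed

subsection \<open>Closed forms and numerical bounds\<close>

text \<open>Leibniz bounds for the alternating series. With the factor \<open>x\<close> pulled out
  only x^2 enters the sum, which is rational even when \<open>x\<close> is a rational multiple of a
  square root.\<close>

lemma arctan_partial_sum_bounds:
  fixes x :: real
  assumes "0 < x" "x \<le> 1"
  shows "x * (\<Sum>i<2*n. (- (x\<^sup>2))^i / (2 * real i + 1)) \<le> arctan x"
    and "arctan x \<le> x * (\<Sum>i<2*n+1. (- (x\<^sup>2))^i / (2 * real i + 1))"
proof -
  have x: "\<bar>x\<bar> \<le> 1" using assms by simp
  define a where "a = (\<lambda>k::nat. 1 / real (k * 2 + 1) * x ^ (k * 2 + 1))"
  have a: "(- 1)^i * a i = x * ((- (x\<^sup>2))^i / (2 * real i + 1))" for i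
    unfolding power_minus[of "x\<^sup>2"] by (simp add: a_def power_mult[symmetric] algebra_simps)
  have "0 < a 0" using assms by (simp add: a_def)
  moreover have "a \<longlonglongrightarrow> 0" unfolding a_def using zeroseq_arctan_series[OF x] by simp
  moreover have "monoseq a" unfolding a_def using monoseq_arctan_series[OF x] by simp
  ultimately have "\<forall>n. (\<Sum>i. (- 1)^i * a i) \<in> {\<Sum>i<2*n. (- 1)^i * a i .. \<Sum>i<2*n+1. (- 1)^i * a i}"
    using summable_Leibniz(2) by blast
  moreover have "arctan x = (\<Sum>i. (- 1)^i * a i)" using arctan_series[OF x] by (simp add: a_def)
  ultimately show "x * (\<Sum>i<2*n. (- (x\<^sup>2))^i / (2 * real i + 1)) \<le> arctan x"
    "arctan x \<le> x * (\<Sum>i<2*n+1. (- (x\<^sup>2))^i / (2 * real i + 1))"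
    unfolding a sum_distrib_left by auto
qed

text \<open>Machin's formula pi / 4 = 4 arctan (1/5) - arctan (1/239), with 10 or 11 terms of the
  first series and 4 or 5 of the second.\<close>

lemma pi_bounds: "3.1415926535896 < pi" "pi < 3.14159265359"
proof -
  have a: "0.19739555984987 \<le> arctan (1/5)" "arctan (1/5) \<le> 0.19739555984989"
    using arctan_partial_sum_bounds(1)[of "1/5" 5] arctan_partial_sum_bounds(2)[of "1/5" 5]
    by (simp_all add: eval_nat_numeral)
  have b: "0.0041840760020746 \<le> arctan (1/239)" "arctan (1/239) \<le> 0.0041840760020748"
    using arctan_partial_sum_bounds(1)[of "1/239" 2] arctan_partial_sum_bounds(2)[of "1/239" 2]
    by (simp_all add: eval_nat_numeral)
  show "3.1415926535896 < pi" "pi < 3.14159265359"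
    using a b machin by (simp_all add: field_simps)
qed


lemma deriv_sec4:
  assumes "cos r \<noteq> (0::real)"
  shows "((\<lambda>s. 1 / cos s ^ 4) has_real_derivative 4 * sin r / cos r ^ 5) (at r)"
  by (auto intro!: derivative_eq_intros simp: assms divide_simps eval_nat_numeral)

lemma sec4_integral_eq:
  assumes "0 \<le> R" "R < pi / 2"
  shows "sec4_integral R f = integral {0..R} (\<lambda>r. f r * (4 * sin r / cos r ^ 5))"
  unfolding sec4_integral_def
proof (rule integral_cong)
  fix r assume "r \<in> {0..R}"
  then have "cos r \<noteq> 0" using assms cos_gt_zero_pi[of r] by auto
  then show "f r * deriv (\<lambda>s. 1 / cos s ^ 4) r = f r * (4 * sin r / cos r ^ 5)"
    using DERIV_imp_deriv[OF deriv_sec4] by metis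
qed

lemma deriv_C: "(C has_real_derivative 4 * pi * (sin r)\<^sup>2) (at r)"
proof -
  have "cos (2 * r) = 1 - 2 * (sin r)\<^sup>2" by (simp add: cos_double_sin)
  then have eq: "4 * pi * (sin r)\<^sup>2 = pi * (2 - 2 * cos (2 * r))" by simp
  show ?thesis unfolding C_def[abs_def] eq
    by (auto intro!: derivative_eq_intros)
qed

text \<open>Integration by parts: the derivative of \<open>C\<close> is 4 pi sin^2, so the remaining
  integrand is 92 pi tan^2 sec^2, with antiderivative 92 pi / 3 tan^3.\<close>

lemma sec4_integral_C:
  assumes R: "0 \<le> R" "R < pi / 2"
  shows "sec4_integral R (\<lambda>r. 2 * pi\<^sup>2 - 23 * C r) =
    (2 * pi\<^sup>2 - 23 * C R) / cos R ^ 4 - 2 * pi\<^sup>2 + 92 * pi / 3 * tan R ^ 3"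
proof -
  let ?F = "\<lambda>r. (2 * pi\<^sup>2 - 23 * C r) * (1 / cos r ^ 4) + 92 * pi / 3 * tan r ^ 3"
  have "((\<lambda>r. (2 * pi\<^sup>2 - 23 * C r) * (4 * sin r / cos r ^ 5)) has_integral ?F R - ?F 0) {0..R}"
  proof (rule fundamental_theorem_of_calculus[OF R(1)])
    fix r assume "r \<in> {0..R}"
    then have c: "cos r \<noteq> 0" using R cos_gt_zero_pi[of r] by auto
    have "(?F has_real_derivative (2 * pi\<^sup>2 - 23 * C r) * (4 * sin r / cos r ^ 5)) (at r)"
      by (rule derivative_eq_intros deriv_C deriv_sec4 refl c)+
        (use c in \<open>simp add: tan_def field_simps eval_nat_numeral\<close>)
    then show "(?F has_vector_derivative (2 * pi\<^sup>2 - 23 * C r) * (4 * sin r / cos r ^ 5)) (at r within {0..R})"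
      by (simp add: has_real_derivative_iff_has_vector_derivative has_vector_derivative_at_within)
  qed
  then show ?thesis
    by (subst sec4_integral_eq[OF R]) (simp add: integral_unique C_def)
qed

lemma r_star_bounds: "0 < r_star" "r_star < pi / 3"
  and sin_r_star: "sin r_star = 1 / sqrt 3"
  and cos_r_star: "cos r_star = sqrt 2 / sqrt 3"
proof -
  have s: "0 < 1 / sqrt 3" "1 / sqrt 3 < sqrt 3 / 2" by (simp_all add: field_simps)
  have "sqrt 3 / 2 \<le> 1" by (simp add: real_le_lsqrt)
  with s have m: "- 1 \<le> 1 / sqrt 3" "1 / sqrt 3 \<le> 1" by linarith+
  then show "0 < r_star" using s arcsin_less_arcsin[of 0 "1 / sqrt 3"] by (simp add: r_star_def)
  have "arcsin (sqrt 3 / 2) = pi / 3" using arcsin_sin[of "pi / 3"] by (simp add: sin_60)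
  then show "r_star < pi / 3"
    using s arcsin_less_arcsin[of "1 / sqrt 3" "sqrt 3 / 2"] \<open>sqrt 3 / 2 \<le> 1\<close> m
    unfolding r_star_def by linarith
  show "sin r_star = 1 / sqrt 3" unfolding r_star_def using m by (rule sin_arcsin)
  have "cos r_star = sqrt (1 - (1 / sqrt 3)\<^sup>2)" unfolding r_star_def using m by (rule cos_arcsin)
  also have "1 - (1 / sqrt 3)\<^sup>2 = 2 / 3" by (simp add: power_divide)
  finally show "cos r_star = sqrt 2 / sqrt 3" by (simp add: real_sqrt_divide)
qed

text \<open>Three times the angle is a little more than a right angle, and the tangent of the excess
  is small. This trades the arcsine for pi and a quickly converging arctangent.\<close>

lemma r_star_eq: "r_star = pi / 6 + arctan (sqrt 2 / 5) / 3"
proof -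
  let ?t = "3 * r_star - pi / 2"
  let ?s = "sin r_star" and ?c = "cos r_star"
  have s2: "?s\<^sup>2 = 1 / 3" and c2: "?c\<^sup>2 = 2 / 3"
    by (simp_all add: sin_r_star cos_r_star power_divide)
  have three: "3 * r_star = r_star + 2 * r_star" by simp
  have "sin (3 * r_star) = ?s * (?c\<^sup>2 - ?s\<^sup>2) + 2 * ?s * ?c\<^sup>2"
    unfolding three sin_add sin_double cos_double by (simp add: power2_eq_square algebra_simps)
  then have sin3: "sin (3 * r_star) = 5 / 3 * ?s" by (simp add: s2 c2)
  have "cos (3 * r_star) = ?c * (?c\<^sup>2 - ?s\<^sup>2) - 2 * ?s\<^sup>2 * ?c"
    unfolding three cos_add sin_double cos_double by (simp add: power2_eq_square algebra_simps)
  then have cos3: "cos (3 * r_star) = - ?c / 3" by (simp add: s2 c2)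
  have "tan ?t = sqrt 2 / 5"
    unfolding tan_def sin_diff cos_diff sin3 cos3 sin_r_star cos_r_star by (simp add: field_simps)
  moreover have "- (pi / 2) < ?t" "?t < pi / 2" using r_star_bounds by auto
  ultimately have "arctan (sqrt 2 / 5) = ?t" by (intro arctan_unique)
  then show ?thesis by (simp add: field_simps)
qed

lemma r_4_bounds: "pi / 6 < r_4" "r_4 < pi / 4"
  and sin_r_4: "sin r_4 = sqrt (3 / 8)"
  and cos_r_4: "cos r_4 = sqrt (5 / 8)"
proof -
  have "1 / 2 < sqrt (3 / 8)" by (rule real_less_rsqrt) (simp add: power_divide)
  moreover have "sqrt (3 / 8) < sqrt 2 / 2"
    by (rule real_less_lsqrt) (simp_all add: power_divide)
  moreover have "sqrt 2 / 2 \<le> 1" by (simp add: real_le_lsqrt)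
  moreover have "arcsin (1 / 2) = pi / 6" using arcsin_sin[of "pi / 6"] by (simp add: sin_30)
  moreover have "arcsin (sqrt 2 / 2) = pi / 4" using arcsin_sin[of "pi / 4"] by (simp add: sin_45)
  ultimately show "pi / 6 < r_4" "r_4 < pi / 4"
    using arcsin_less_arcsin[of "1 / 2" "sqrt (3 / 8)"] arcsin_less_arcsin[of "sqrt (3 / 8)" "sqrt 2 / 2"]
    by (simp_all add: r_4_def)
  show "sin r_4 = sqrt (3 / 8)" by (simp add: r_4_def sin_arcsin real_le_lsqrt order_trans[of _ 0])
  show "cos r_4 = sqrt (5 / 8)" by (simp add: r_4_def cos_arcsin real_le_lsqrt order_trans[of _ 0])
qed

text \<open>The double angle has cosine 1/4, and five times that double angle exceeds a full turn
  only slightly. Sines and cosines of 2, 4, 8 and 10 times \<open>r_4\<close> are computed to find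
  the tangent of the excess.\<close>

lemma r_4_eq: "r_4 = pi / 5 + arctan (5 * sqrt 15 / 61) / 10"
proof -
  define s where "s = sqrt 15"
  have ss: "s * s = 15" by (simp add: s_def)
  have "cos (2 * r_4) = (cos r_4)\<^sup>2 - (sin r_4)\<^sup>2" by (rule cos_double)
  then have c1: "cos (2 * r_4) = 1 / 4" by (simp add: cos_r_4 sin_r_4)
  have "sqrt (3 / 8) * sqrt (5 / 8) = sqrt (15 / 64)" by (simp add: real_sqrt_mult[symmetric])
  also have "\<dots> = s / 8" by (simp add: s_def real_sqrt_divide)
  finally have s1: "sin (2 * r_4) = s / 4" by (simp add: sin_double sin_r_4 cos_r_4)
  have four: "4 * r_4 = 2 * (2 * r_4)" and eight: "8 * r_4 = 2 * (4 * r_4)"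
    and ten: "10 * r_4 = 8 * r_4 + 2 * r_4" by simp_all
  have s2: "sin (4 * r_4) = s / 8" and c2: "cos (4 * r_4) = - 7 / 8"
    unfolding four sin_double[of "2 * r_4"] cos_double[of "2 * r_4"] c1 s1
    by (simp_all add: power2_eq_square ss)
  have s4: "sin (8 * r_4) = - 7 * s / 32" and c4: "cos (8 * r_4) = 17 / 32"
    unfolding eight sin_double[of "4 * r_4"] cos_double[of "4 * r_4"] c2 s2
    by (simp_all add: power2_eq_square ss)
  have s5: "sin (10 * r_4) = 5 * s / 64" and c5: "cos (10 * r_4) = 61 / 64"
    unfolding ten sin_add cos_add c4 s4 c1 s1 by (simp_all add: ss)
  let ?t = "10 * r_4 - 2 * pi"
  have "tan ?t = 5 * s / 61"
    unfolding tan_def sin_diff cos_diff s5 c5 by simp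
  moreover have "- (pi / 2) < ?t" "?t < pi / 2" using r_4_bounds by auto
  ultimately have "arctan (5 * s / 61) = ?t" by (intro arctan_unique)
  then show ?thesis by (simp add: s_def field_simps)
qed

text \<open>The quotient of the arctangent by sqrt 2 is kept as a unit because its series has
  rational terms; the irrational factors left are sqrt 2 and pi.\<close>

lemma A_star_eq:
  "A_star = sqrt 2 * pi * (69 / 8 * (1 - arctan (sqrt 2 / 5) / sqrt 2) + 23 / 12) - 51 / 16 * pi\<^sup>2"
proof -
  let ?d = "arctan (sqrt 2 / 5)"
  have t: "tan r_star ^ 3 = sqrt 2 / 4"
    by (simp add: tan_def sin_r_star cos_r_star eval_nat_numeral field_simps)
  have "sin (2 * r_star) = 2 * sqrt 2 / 3" by (simp add: sin_double sin_r_star cos_r_star)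
  then have C: "C r_star = pi * (pi / 3 + 2 * ?d / 3 - 2 * sqrt 2 / 3)"
    by (simp add: C_def) (simp add: r_star_eq)
  have c: "cos r_star ^ 4 = 4 / 9"
    by (simp add: cos_r_star power_divide eval_nat_numeral)
  have d: "sqrt 2 * (?d / sqrt 2) = ?d" by simp
  have "A_star = 1 / 4 * ((2 * pi\<^sup>2 - 23 * C r_star) * (9 / 4) + 92 * pi / 3 * (sqrt 2 / 4))"
    using sec4_integral_C[of r_star] r_star_bounds unfolding A_star_def t c by simp
  also have "\<dots> = sqrt 2 * pi * (69 / 8 + 23 / 12) - 69 / 8 * pi * ?d - 51 / 16 * pi\<^sup>2"
    unfolding C by (simp add: algebra_simps power2_eq_square)
  also have "69 / 8 * pi * ?d = 69 / 8 * pi * (sqrt 2 * (?d / sqrt 2))" using d by simp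
  finally show ?thesis by (simp add: algebra_simps del: nonzero_mult_div_cancel_left)
qed

lemma A_4_eq:
  "A_4 = sqrt 15 * pi * (23 / 5 - 368 / 125 * (arctan (5 * sqrt 15 / 61) / sqrt 15)) - 576 / 125 * pi\<^sup>2"
proof -
  let ?d = "arctan (5 * sqrt 15 / 61)"
  have sc: "sqrt (3 / 8) * sqrt (5 / 8) = sqrt 15 / 8"
    by (simp add: real_sqrt_mult[symmetric] real_sqrt_divide)
  have t: "tan r_4 = sqrt 15 / 5"
  proof -
    have "tan r_4 = (sqrt (3 / 8) * sqrt (5 / 8)) / (sqrt (5 / 8) * sqrt (5 / 8))"
      unfolding tan_def sin_r_4 cos_r_4 by (subst mult_divide_mult_cancel_right) simp_all
    then show ?thesis unfolding sc by simp
  qed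
  have t3: "tan r_4 ^ 3 = 3 * sqrt 15 / 25" unfolding t by (simp add: eval_nat_numeral)
  have "sin (2 * r_4) = sqrt 15 / 4" using sc by (simp add: sin_double sin_r_4 cos_r_4)
  then have C: "C r_4 = pi * (2 * pi / 5 + ?d / 5 - sqrt 15 / 4)"
    by (simp add: C_def) (simp add: r_4_eq)
  have c: "cos r_4 ^ 4 = 25 / 64"
    by (simp add: cos_r_4 eval_nat_numeral)
  have d: "sqrt 15 * (?d / sqrt 15) = ?d" by simp
  have "A_4 = 1 / 4 * ((2 * pi\<^sup>2 - 23 * C r_4) * (64 / 25) + 92 * pi / 3 * (3 * sqrt 15 / 25))"
    using sec4_integral_C[of r_4] r_4_bounds unfolding A_4_def t3 c by simp
  also have "\<dots> = sqrt 15 * pi * (23 / 5) - 368 / 125 * pi * ?d - 576 / 125 * pi\<^sup>2"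
    unfolding C by (simp add: algebra_simps power2_eq_square)
  also have "368 / 125 * pi * ?d = 368 / 125 * pi * (sqrt 15 * (?d / sqrt 15))" using d by simp
  finally show ?thesis by (simp add: algebra_simps del: nonzero_mult_div_cancel_left)
qed


lemma A_star_bound: "\<bar>(8 - A_star) - 0.092855570\<bar> < 5 / 10 ^ 10"
proof -
  define d where "d = arctan (sqrt 2 / 5) / sqrt 2"
  have x: "0 < sqrt 2 / 5" "sqrt 2 / 5 \<le> 1" "(sqrt 2 / 5)\<^sup>2 = 2 / 25"
    by (simp_all add: real_le_lsqrt power_divide)
  have sq: "1.4142135623730 \<le> sqrt 2" "sqrt 2 \<le> 1.4142135623731"
    by (intro real_le_rsqrt real_le_lsqrt; simp add: power_divide)+
  \<comment> \<open>The decimals here and in the upper bound enclose the partial sums with 10 and 11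
    terms at x^2 = 2/25.\<close>
  have "sqrt 2 / 5 * 0.97454446255 \<le> arctan (sqrt 2 / 5)"
    by (rule order_trans[OF _ arctan_partial_sum_bounds(1)[OF x(1,2), of 5]], unfold x(3), rule mult_left_mono)
      (simp_all add: eval_nat_numeral)
  then have d1: "0.194908892510 \<le> d" by (simp add: d_def field_simps)
  have "arctan (sqrt 2 / 5) \<le> sqrt 2 / 5 * 0.97454446256"
    by (rule order_trans[OF arctan_partial_sum_bounds(2)[OF x(1,2), of 5]], unfold x(3), rule mult_left_mono)
      (simp_all add: eval_nat_numeral)
  then have d2: "d \<le> 0.194908892512" by (simp add: d_def field_simps)
  have "1.4142135623730 * 3.1415926535896 \<le> sqrt 2 * pi"
    by (rule mult_mono) (use sq pi_bounds in simp_all)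
  then have "1.4142135623730 * 3.1415926535896 * (69 / 8 * (1 - 0.194908892512) + 23 / 12)
      \<le> sqrt 2 * pi * (69 / 8 * (1 - d) + 23 / 12)"
    by (rule mult_mono) (use d2 in simp_all)
  moreover have "sqrt 2 * pi \<le> 1.4142135623731 * 3.14159265359"
    by (rule mult_mono) (use sq pi_bounds in simp_all)
  then have "sqrt 2 * pi * (69 / 8 * (1 - d) + 23 / 12)
      \<le> 1.4142135623731 * 3.14159265359 * (69 / 8 * (1 - 0.194908892510) + 23 / 12)"
    by (rule mult_mono) (use d1 d2 in simp_all)
  moreover have "3.1415926535896\<^sup>2 \<le> pi\<^sup>2" "pi\<^sup>2 \<le> 3.14159265359\<^sup>2"
    using pi_bounds by (intro power_mono; simp)+
  ultimately show ?thesis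
    unfolding A_star_eq d_def[symmetric] abs_less_iff by (simp add: power2_eq_square)
qed

lemma A_4_bound: "\<bar>(8 - A_4) - 0.352442\<bar> < 5 / 10 ^ 7"
proof -
  define d where "d = arctan (5 * sqrt 15 / 61) / sqrt 15"
  have sq: "3.872983346207 \<le> sqrt 15" "sqrt 15 \<le> 3.872983346208"
    by (intro real_le_rsqrt real_le_lsqrt; simp add: power_divide)+
  have x: "0 < 5 * sqrt 15 / 61" "5 * sqrt 15 / 61 \<le> 1" "(5 * sqrt 15 / 61)\<^sup>2 = 375 / 3721"
    using sq by (simp_all add: power_divide power_mult_distrib)
  have "5 * sqrt 15 / 61 * 0.968302543 \<le> arctan (5 * sqrt 15 / 61)"
    by (rule order_trans[OF _ arctan_partial_sum_bounds(1)[OF x(1,2), of 5]], unfold x(3), rule mult_left_mono)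
      (simp_all add: eval_nat_numeral)
  then have "0.968302543 * 5 / 61 \<le> d" by (simp add: d_def field_simps)
  then have d1: "0.0793690609 \<le> d" by simp
  have "arctan (5 * sqrt 15 / 61) \<le> 5 * sqrt 15 / 61 * 0.968302544"
    by (rule order_trans[OF arctan_partial_sum_bounds(2)[OF x(1,2), of 5]], unfold x(3), rule mult_left_mono)
      (simp_all add: eval_nat_numeral)
  then have "d \<le> 0.968302544 * 5 / 61" by (simp add: d_def field_simps)
  then have d2: "d \<le> 0.079369061" by simp
  have "3.872983346207 * 3.1415926535896 \<le> sqrt 15 * pi"
    by (rule mult_mono) (use sq pi_bounds in simp_all)
  then have "3.872983346207 * 3.1415926535896 * (23 / 5 - 368 / 125 * 0.079369061)
      \<le> sqrt 15 * pi * (23 / 5 - 368 / 125 * d)"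
    by (rule mult_mono) (use d2 in simp_all)
  moreover have "sqrt 15 * pi \<le> 3.872983346208 * 3.14159265359"
    by (rule mult_mono) (use sq pi_bounds in simp_all)
  then have "sqrt 15 * pi * (23 / 5 - 368 / 125 * d)
      \<le> 3.872983346208 * 3.14159265359 * (23 / 5 - 368 / 125 * 0.0793690609)"
    by (rule mult_mono) (use d1 d2 in simp_all)
  moreover have "3.1415926535896\<^sup>2 \<le> pi\<^sup>2" "pi\<^sup>2 \<le> 3.14159265359\<^sup>2"
    using pi_bounds by (intro power_mono; simp)+
  ultimately show ?thesis
    unfolding A_4_eq d_def[symmetric] abs_less_iff by (simp add: power2_eq_square)
qed

subsection \<open>Surface measure and rotations\<close>

lemma sphere_measure_finite: "finite_measure sphere_measure"
proof
  have "emeasure sphere_measure (sphere 0 1) =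
      4 * emeasure lborel {x :: real^4. x \<noteq> 0 \<and> norm x \<le> 1 \<and> sgn x \<in> sphere 0 1}"
    by (rule emeasure_sphere_measure) auto
  also have "emeasure lborel {x :: real^4. x \<noteq> 0 \<and> norm x \<le> 1 \<and> sgn x \<in> sphere 0 1}
      \<le> emeasure lborel (cball (0::real^4) 1)"
    by (rule emeasure_mono) auto
  then have "4 * emeasure lborel {x :: real^4. x \<noteq> 0 \<and> norm x \<le> 1 \<and> sgn x \<in> sphere 0 1} \<noteq> \<infinity>"
    using emeasure_bounded_finite[of "cball (0::real^4) 1"]
    by (auto simp: ennreal_mult_eq_top_iff top_unique)
  finally show "emeasure sphere_measure (space sphere_measure) \<noteq> \<infinity>"
    by (simp add: space_sphere_measure)
qed

interpretation sphere_measure: finite_measure sphere_measure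
  by (rule sphere_measure_finite)

lemma sets_sphere_measure: "A \<in> sets sphere_measure \<longleftrightarrow> A \<in> sets borel \<and> A \<subseteq> sphere 0 1"
  by (auto simp: sphere_measure_def sets_restrict_space_iff)

definition sector :: "(real^4) set \<Rightarrow> real \<Rightarrow> (real^4) set" where
  "sector A t = {x. x \<noteq> 0 \<and> norm x \<le> t \<and> sgn x \<in> A}"

lemma sgn_borel_measurable [measurable]: "(sgn :: real^4 \<Rightarrow> _) \<in> borel_measurable borel"
  unfolding sgn_div_norm by measurable

lemma sector_measurable [measurable]:
  assumes [measurable]: "A \<in> sets borel"
  shows "sector A t \<in> sets borel"
  unfolding sector_def by measurable

lemma sector_finite: "emeasure lborel (sector A t) < \<infinity>"
  by (rule emeasure_bounded_finite, rule bounded_subset[of "cball 0 t"]) (auto simp: sector_def)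

lemma measure_sector_1:
  assumes "A \<in> sets borel" "A \<subseteq> sphere 0 1"
  shows "measure sphere_measure A = 4 * measure lborel (sector A 1)"
  using emeasure_sphere_measure[OF assms]
  by (simp add: measure_def sector_def enn2real_mult)

lemma measure_sector:
  assumes "A \<in> sets borel" "A \<subseteq> sphere 0 1" "0 < t"
  shows "measure lborel (sector A t) = t ^ 4 * measure sphere_measure A / 4"
proof -
  have "sector A t = (\<lambda>x. t *\<^sub>R x + 0) ` sector A 1"
  proof (intro set_eqI iffI)
    fix x assume x: "x \<in> sector A t"
    have "sgn ((1 / t) *\<^sub>R x) = sgn x" using assms(3) by (simp add: sgn_scaleR)
    then have "(1 / t) *\<^sub>R x \<in> sector A 1" using x assms(3) by (simp add: sector_def)
    moreover have "x = t *\<^sub>R ((1 / t) *\<^sub>R x) + 0" using assms(3) by simp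
    ultimately show "x \<in> (\<lambda>x. t *\<^sub>R x + 0) ` sector A 1" by blast
  next
    fix x assume "x \<in> (\<lambda>x. t *\<^sub>R x + 0) ` sector A 1"
    then show "x \<in> sector A t" using assms(3) by (auto simp: sector_def sgn_scaleR)
  qed
  then have "measure lebesgue (sector A t) = t ^ 4 * measure lebesgue (sector A 1)"
    using measure_lebesgue_affine[of t 0 "sector A 1"] assms(3) by simp
  moreover have "measure lebesgue (sector A s) = measure lborel (sector A s)" for s
    using sector_measurable[OF assms(1)] by (intro measure_completion) simp
  ultimately show ?thesis using measure_sector_1[OF assms(1,2)] by simp
qed

lemma measure_shell:
  assumes "A \<in> sets borel" "A \<subseteq> sphere 0 1" "0 < s" "s \<le> t"
  shows "measure lborel {x. s < norm x \<and> norm x \<le> t \<and> sgn x \<in> A} =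
    (t ^ 4 - s ^ 4) * measure sphere_measure A / 4"
proof -
  have "{x. s < norm x \<and> norm x \<le> t \<and> sgn x \<in> A} = sector A t - sector A s"
    using assms(3) by (auto simp: sector_def)
  moreover have "measure lborel (sector A t - sector A s) = measure lborel (sector A t) - measure lborel (sector A s)"
    using sector_measurable[OF assms(1)] sector_finite[of A t] assms(4)
    by (intro measure_Diff) (auto simp: sector_def)
  ultimately show ?thesis using assms by (simp add: measure_sector field_simps)
qed

section \<open>Reflections, Gram matrices and rotation invariance\<close>

text \<open>The reflection in the hyperplane that bisects \<open>a\<close> and \<open>b\<close>; it
  fixes every vector having equal inner products with both. If a = b, the quotient in
  \<open>c\<close> is a division by zero, hence 0, and the map is the identity.\<close>

lemma swapping_reflection_exists:
  fixes a b :: "'a::real_inner"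
  assumes "norm a = norm b"
  obtains f where "orthogonal_transformation f" "f a = b" "\<And>x. x \<bullet> a = x \<bullet> b \<Longrightarrow> f x = x"
proof -
  define d where "d = a - b"
  define c where "c x = 2 * (x \<bullet> d) / (d \<bullet> d)" for x
  define f where "f x = x - c x *\<^sub>R d" for x
  have "linear f"
    by (rule linearI) (simp_all add: f_def c_def inner_add_left algebra_simps add_divide_distrib)
  moreover have "f x \<bullet> f y = x \<bullet> y" for x y
  proof -
    have q: "c z * (d \<bullet> d) = 2 * (z \<bullet> d)" for z by (simp add: c_def)
    have "f x \<bullet> f y = x \<bullet> y - c y * (x \<bullet> d) - c x * (y \<bullet> d) + c x * (c y * (d \<bullet> d))"
      by (simp add: f_def inner_diff_left inner_diff_right inner_commute[of d y] right_diff_distrib)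
    also have "\<dots> = x \<bullet> y - c y * (x \<bullet> d) + c x * (y \<bullet> d)" by (simp add: q)
    also have "c x * (y \<bullet> d) = c y * (x \<bullet> d)" by (simp add: c_def)
    finally show ?thesis by simp
  qed
  ultimately have "orthogonal_transformation f" by (simp add: orthogonal_transformation_def)
  moreover have "f a = b"
  proof (cases "d = 0")
    case False
    have "a \<bullet> a = b \<bullet> b" using assms by (simp add: norm_eq)
    then have "2 * (a \<bullet> d) = d \<bullet> d"
      by (simp add: d_def inner_diff_left inner_diff_right inner_commute[of b a])
    then have "c a = 1" using False by (simp add: c_def)
    then show ?thesis by (simp add: f_def d_def)
  qed (simp add: f_def d_def)
  moreover have "f x = x" if "x \<bullet> a = x \<bullet> b" for x
    using that by (simp add: f_def c_def d_def inner_diff_right)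
  ultimately show ?thesis using that by blast
qed

text \<open>Vectors are matched one at a time. Once \<open>f\<close> matches the earlier ones, the
  reflection taking f (a n) to b n fixes every earlier b i, because equality of the Gram entries
  gives b i . f (a n) = a i . a n = b i . b n.\<close>

lemma orthogonal_transformation_equal_Gram:
  fixes a b :: "nat \<Rightarrow> 'a::real_inner"
  assumes "\<And>i j. i < n \<Longrightarrow> j < n \<Longrightarrow> a i \<bullet> a j = b i \<bullet> b j"
  shows "\<exists>f. orthogonal_transformation f \<and> (\<forall>i<n. f (a i) = b i)"
  using assms
proof (induction n)
  case 0
  show ?case by (intro exI[of _ "\<lambda>x. x"]) simp
next
  case (Suc n)
  then obtain f where f: "orthogonal_transformation f" "\<And>i. i < n \<Longrightarrow> f (a i) = b i" by auto
  have "norm (f (a n)) = norm (b n)"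
    using f(1) Suc.prems[of n n] by (simp add: orthogonal_transformation_norm norm_eq)
  then obtain g where g: "orthogonal_transformation g" "g (f (a n)) = b n"
    "\<And>x. x \<bullet> f (a n) = x \<bullet> b n \<Longrightarrow> g x = x"
    using swapping_reflection_exists by blast
  have "g (b i) = b i" if "i < n" for i
  proof (rule g(3))
    have "b i \<bullet> f (a n) = f (a i) \<bullet> f (a n)" using f(2) that by simp
    also have "\<dots> = b i \<bullet> b n"
      using f(1) Suc.prems[of i n] that by (simp add: orthogonal_transformation_def)
    finally show "b i \<bullet> f (a n) = b i \<bullet> b n" .
  qed
  then have "\<forall>i<Suc n. (g \<circ> f) (a i) = b i" using f(2) g(2) by (auto simp: less_Suc_eq)
  moreover have "orthogonal_transformation (g \<circ> f)"
    using f(1) g(1) by (rule orthogonal_transformation_compose[rotated])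
  ultimately show ?case by blast
qed

lemma inner_eq_if_angle_eq:
  assumes "u \<in> sphere 0 1" "v \<in> sphere 0 1" "u' \<in> sphere 0 1" "v' \<in> sphere 0 1" "angle u v = angle u' v'"
  shows "u \<bullet> v = u' \<bullet> v'"
proof -
  have "\<bar>u \<bullet> v\<bar> \<le> 1" "\<bar>u' \<bullet> v'\<bar> \<le> 1"
    using assms Cauchy_Schwarz_ineq2[of u v] Cauchy_Schwarz_ineq2[of u' v'] by auto
  then show ?thesis using assms(5) arccos_eq_iff by (simp add: angle_def)
qed

text \<open>An orthogonal map commutes with \<open>sgn\<close> and keeps norms, so it carries the
  cone over \<open>A\<close> to the cone over the image, and it preserves Lebesgue measure.
  Compactness makes the image a Borel set.\<close>

lemma measure_sphere_orthogonal_image: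
  assumes f: "orthogonal_transformation f" and A: "compact A" "A \<subseteq> sphere 0 1"
  shows "measure sphere_measure (f ` A) = measure sphere_measure A"
proof -
  have lin: "linear f" and nf: "\<And>x. norm (f x) = norm x"
    using f by (simp_all add: orthogonal_transformation_linear orthogonal_transformation_norm)
  have inj: "inj f" and surj: "surj f"
    using f by (simp_all add: orthogonal_transformation_inj orthogonal_transformation_surj)
  have sg: "sgn (f x) = f (sgn x)" for x
    by (simp add: sgn_div_norm nf linear_scale[OF lin])
  have fA: "f ` A \<in> sets borel"
    using compact_continuous_image[OF linear_continuous_on[OF lin[unfolded linear_conv_bounded_linear]] A(1)]
    by (rule borel_compact)
  have A': "A \<in> sets borel" using A by (simp add: borel_compact)
  have "sector (f ` A) 1 = f ` sector A 1"
  proof (intro set_eqI iffI)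
    fix y assume y: "y \<in> sector (f ` A) 1"
    obtain x where x: "y = f x" using surj by blast
    have "f (sgn x) \<in> f ` A" using y by (simp add: sector_def x sg)
    then have "sgn x \<in> A" using inj by (simp add: inj_image_mem_iff)
    moreover have "x \<noteq> 0" using y linear_0[OF lin] by (auto simp: sector_def x)
    ultimately show "y \<in> f ` sector A 1" using y by (auto simp: sector_def x nf)
  next
    fix y assume "y \<in> f ` sector A 1"
    then obtain x where x: "y = f x" "x \<in> sector A 1" by blast
    then have "f x \<noteq> 0" using nf[of x] by (auto simp: sector_def)
    then show "y \<in> sector (f ` A) 1" using x by (auto simp: sector_def sg nf)
  qed
  moreover have lm: "sector A 1 \<in> lmeasurable"
    using sector_measurable[OF A'] sector_finite by (auto intro!: fmeasurableI)
  moreover have "measure lebesgue (f ` sector A 1) = measure lebesgue (sector A 1)"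
    using f lm by (rule measure_orthogonal_image)
  moreover have "measure lebesgue (sector B 1) = measure lborel (sector B 1)" if "B \<in> sets borel" for B
    using sector_measurable[OF that] by (intro measure_completion) simp
  ultimately have "measure lborel (sector (f ` A) 1) = measure lborel (sector A 1)"
    using fA A' by metis
  moreover have "f ` A \<subseteq> sphere 0 1" using A nf by auto
  ultimately show ?thesis using fA A' A(2) by (simp add: measure_sector_1)
qed

lemma cap_eq_inner:
  assumes "c \<in> sphere 0 1" "0 \<le> r" "r \<le> pi"
  shows "cap c r = {u \<in> sphere 0 1. cos r \<le> u \<bullet> c}"
proof -
  have "angle u c \<le> r \<longleftrightarrow> cos r \<le> u \<bullet> c" if "u \<in> sphere 0 1" for u
  proof -
    have "\<bar>u \<bullet> c\<bar> \<le> 1" using assms that Cauchy_Schwarz_ineq2[of u c] by auto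
    then have "angle u c \<le> r \<longleftrightarrow> arccos (u \<bullet> c) \<le> arccos (cos r)"
      using assms by (simp add: angle_def arccos_cos)
    also have "\<dots> \<longleftrightarrow> cos r \<le> u \<bullet> c" using \<open>\<bar>u \<bullet> c\<bar> \<le> 1\<close> by (intro arccos_le_mono) auto
    finally show ?thesis .
  qed
  then show ?thesis by (auto simp: cap_def)
qed

lemma compact_cap:
  assumes "c \<in> sphere 0 1" "0 \<le> r" "r \<le> pi"
  shows "compact (cap c r)"
proof -
  have "cap c r = sphere 0 1 \<inter> {u. cos r \<le> c \<bullet> u}"
    unfolding cap_eq_inner[OF assms] by (simp add: inner_commute[of c] Int_def)
  then show ?thesis by (auto intro!: compact_Int_closed closed_halfspace_ge)
qed

lemma cap_subset: "cap c r \<subseteq> sphere 0 1"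
  by (auto simp: cap_def)

lemma orthogonal_image_cap:
  assumes f: "orthogonal_transformation f"
  shows "f ` cap c r = cap (f c) r"
proof -
  have surj: "surj f" using f by (rule orthogonal_transformation_surj)
  have "f u \<in> cap (f c) r \<longleftrightarrow> u \<in> cap c r" for u
    using f by (simp add: cap_def angle_def orthogonal_transformation_norm orthogonal_transformation_def)
  then show ?thesis using surj by (auto simp: image_iff) (metis surjD)
qed

text \<open>The description is well defined because unit vectors at equal angles have equal Gram
  matrices: some orthogonal map takes one pair of centres to the other, and with them the
  intersection of the caps.\<close>

lemma Lam_eq:
  assumes "u \<in> sphere 0 1" "v \<in> sphere 0 1" "0 \<le> r" "r \<le> pi"
  shows "Lam r (angle u v) = measure sphere_measure (cap u r \<inter> cap v r)"
  unfolding Lam_def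
proof (rule the_equality)
  fix m assume "\<exists>u'\<in>sphere 0 1. \<exists>v'\<in>sphere 0 1. angle u' v' = angle u v \<and>
     m = measure sphere_measure (cap u' r \<inter> cap v' r)"
  then obtain u' v' where *: "u' \<in> sphere 0 1" "v' \<in> sphere 0 1" "angle u' v' = angle u v"
     and m: "m = measure sphere_measure (cap u' r \<inter> cap v' r)" by blast
  have i: "u \<bullet> v = u' \<bullet> v'" using inner_eq_if_angle_eq[of u v u' v'] assms * by simp
  have "u \<bullet> u = 1" "v \<bullet> v = 1" "u' \<bullet> u' = 1" "v' \<bullet> v' = 1"
    using assms * by (simp_all add: norm_eq_1)
  then have "[u, v] ! j \<bullet> [u, v] ! k = [u', v'] ! j \<bullet> [u', v'] ! k" if "j < 2" "k < 2" for j k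
    using that i by (auto simp: less_Suc_eq numeral_eq_Suc inner_commute[of v u] inner_commute[of v' u']
        inner_commute[of t u] inner_commute[of t' u'] inner_commute[of t v] inner_commute[of t' v'])
  from orthogonal_transformation_equal_Gram[of 2 "(!) [u, v]" "(!) [u', v']", OF this]
  obtain f where f: "orthogonal_transformation f" "\<forall>i<2. f ([u, v] ! i) = [u', v'] ! i" by blast
  have fu: "f u = u'" "f v = v'" using f(2)[rule_format, of 0] f(2)[rule_format, of 1] by simp_all
  have "inj f" using f(1) by (rule orthogonal_transformation_inj)
  then have "cap u' r \<inter> cap v' r = f ` (cap u r \<inter> cap v r)"
    by (simp add: image_Int orthogonal_image_cap[OF f(1)] fu)
  moreover have "compact (cap u r \<inter> cap v r)" using assms by (intro compact_Int compact_cap)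
  ultimately show "m = measure sphere_measure (cap u r \<inter> cap v r)"
    unfolding m using f(1) cap_subset by (simp add: measure_sphere_orthogonal_image le_infI1)
qed (use assms in blast)

lemma Lam3_eq:
  assumes "u \<in> sphere 0 1" "v \<in> sphere 0 1" "t \<in> sphere 0 1" "0 \<le> r" "r \<le> pi"
  shows "Lam3 r (angle u v) (angle u t) (angle v t) =
    measure sphere_measure (cap u r \<inter> cap v r \<inter> cap t r)"
  unfolding Lam3_def
proof (rule the_equality)
  fix m assume "\<exists>u'\<in>sphere 0 1. \<exists>v'\<in>sphere 0 1. \<exists>t'\<in>sphere 0 1.
     angle u' v' = angle u v \<and> angle u' t' = angle u t \<and> angle v' t' = angle v t \<and>
     m = measure sphere_measure (cap u' r \<inter> cap v' r \<inter> cap t' r)"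
  then obtain u' v' t' where *: "u' \<in> sphere 0 1" "v' \<in> sphere 0 1" "t' \<in> sphere 0 1"
     "angle u' v' = angle u v" "angle u' t' = angle u t" "angle v' t' = angle v t"
     and m: "m = measure sphere_measure (cap u' r \<inter> cap v' r \<inter> cap t' r)" by blast
  have i: "u \<bullet> v = u' \<bullet> v'" "u \<bullet> t = u' \<bullet> t'" "v \<bullet> t = v' \<bullet> t'"
    using inner_eq_if_angle_eq[of u v u' v'] inner_eq_if_angle_eq[of u t u' t']
      inner_eq_if_angle_eq[of v t v' t'] assms * by simp_all
  have "u \<bullet> u = 1" "v \<bullet> v = 1" "t \<bullet> t = 1" "u' \<bullet> u' = 1" "v' \<bullet> v' = 1" "t' \<bullet> t' = 1"
    using assms * by (simp_all add: norm_eq_1)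
  then have "[u, v, t] ! j \<bullet> [u, v, t] ! k = [u', v', t'] ! j \<bullet> [u', v', t'] ! k" if "j < 3" "k < 3" for j k
    using that i by (auto simp: less_Suc_eq numeral_eq_Suc inner_commute[of v u] inner_commute[of v' u']
        inner_commute[of t u] inner_commute[of t' u'] inner_commute[of t v] inner_commute[of t' v'])
  from orthogonal_transformation_equal_Gram[of 3 "(!) [u, v, t]" "(!) [u', v', t']", OF this]
  obtain f where f: "orthogonal_transformation f" "\<forall>i<3. f ([u, v, t] ! i) = [u', v', t'] ! i" by blast
  have fu: "f u = u'" "f v = v'" "f t = t'"
    using f(2)[rule_format, of 0] f(2)[rule_format, of 1] f(2)[rule_format, of 2] by simp_all
  have "inj f" using f(1) by (rule orthogonal_transformation_inj)
  then have "cap u' r \<inter> cap v' r \<inter> cap t' r = f ` (cap u r \<inter> cap v r \<inter> cap t r)"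
    by (simp add: image_Int orthogonal_image_cap[OF f(1)] fu)
  moreover have "compact (cap u r \<inter> cap v r \<inter> cap t r)" using assms by (intro compact_Int compact_cap)
  ultimately show "m = measure sphere_measure (cap u r \<inter> cap v r \<inter> cap t r)"
    unfolding m using f(1) cap_subset by (simp add: measure_sphere_orthogonal_image le_infI1)
qed (use assms in blast)

subsection \<open>The measure of a cap\<close>

lemma sets_radius_le:
  fixes \<rho> :: "real \<Rightarrow> real"
  assumes [measurable]: "u \<in> borel_measurable M" "v \<in> borel_measurable M" and rho: "\<rho> \<in> borel_measurable borel"
  shows "{f \<in> space M. u f \<in> {a..c} \<and> sqrt (v f) \<le> \<rho> (u f)} \<in> sets M"
proof -
  have [measurable]: "(\<lambda>f. \<rho> (u f)) \<in> borel_measurable M"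
    using assms(1) rho by (rule measurable_compose)
  have [measurable]: "{f \<in> space M. sqrt (v f) \<le> \<rho> (u f)} \<in> sets M"
    by (rule borel_measurable_le) measurable
  have "{f \<in> space M. u f \<in> {a..c} \<and> sqrt (v f) \<le> \<rho> (u f)} =
      {f \<in> space M. u f \<in> {a..c}} \<inter> {f \<in> space M. sqrt (v f) \<le> \<rho> (u f)}" by blast
  also have "\<dots> \<in> sets M" by measurable
  finally show ?thesis .
qed

text \<open>Fubini in the coordinate along \<open>b\<close>: the slice at height y is a ball of
  radius \<rho> y in the remaining coordinates.\<close>

lemma emeasure_solid_of_revolution:
  fixes b :: "'a::euclidean_space" and \<rho> :: "real \<Rightarrow> real"
  assumes b: "b \<in> Basis" and rho: "\<rho> \<in> borel_measurable borel"
    and pos: "\<And>y. a < y \<Longrightarrow> y < c \<Longrightarrow> 0 < \<rho> y"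
  shows "emeasure lborel {x::'a. x \<bullet> b \<in> {a..c} \<and> sqrt (\<Sum>i\<in>Basis - {b}. (x \<bullet> i)\<^sup>2) \<le> \<rho> (x \<bullet> b)} =
    (\<integral>\<^sup>+ y. indicator {a..c} y * ennreal (unit_ball_vol (real (DIM('a) - 1)) * \<rho> y ^ (DIM('a) - 1)) \<partial>lborel)"
proof -
  interpret product_sigma_finite "\<lambda>_. lborel :: real measure" by standard
  define A where "A = Basis - {b}"
  have A: "finite A" "b \<notin> A" "Basis = insert b A" "card A = DIM('a) - 1"
    using b by (auto simp: A_def card_Diff_singleton)
  have AB: "A \<subseteq> Basis" by (auto simp: A_def)
  let ?P = "Pi\<^sub>M (insert b A) (\<lambda>_. lborel :: real measure)"
  let ?S = "{x::'a. x \<bullet> b \<in> {a..c} \<and> sqrt (\<Sum>i\<in>A. (x \<bullet> i)\<^sup>2) \<le> \<rho> (x \<bullet> b)}"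
  let ?T = "{f. f b \<in> {a..c} \<and> sqrt (\<Sum>i\<in>A. (f i)\<^sup>2) \<le> \<rho> (f b)}"
  have inner: "(\<Sum>k\<in>Basis. f k *\<^sub>R k) \<bullet> i = f i" if "i \<in> Basis" for f and i :: 'a
    using that by (simp add: inner_sum_left inner_Basis if_distrib cong: if_cong)
  have pre: "(\<lambda>f. \<Sum>k\<in>Basis. f k *\<^sub>R k) -` ?S = ?T"
  proof -
    have "(\<Sum>i\<in>A. ((\<Sum>k\<in>Basis. f k *\<^sub>R k) \<bullet> i)\<^sup>2) = (\<Sum>i\<in>A. (f i)\<^sup>2)" for f
      using AB by (intro sum.cong refl arg_cong[of _ _ "\<lambda>x. x\<^sup>2"] inner) auto
    then show ?thesis using inner[OF b] by simp
  qed
  have T: "?T \<inter> space ?P \<in> sets ?P"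
  proof -
    have m: "(\<lambda>f. f i) \<in> borel_measurable ?P" if "i \<in> insert b A" for i
      using measurable_component_singleton[OF that, of "\<lambda>_. lborel :: real measure"] by simp
    have "(\<lambda>f. f b) \<in> borel_measurable ?P" by (rule m) simp
    moreover have "(\<lambda>f. \<Sum>i\<in>A. (f i)\<^sup>2) \<in> borel_measurable ?P"
      by (intro borel_measurable_sum borel_measurable_power m) simp
    ultimately have "{f \<in> space ?P. f b \<in> {a..c} \<and> sqrt (\<Sum>i\<in>A. (f i)\<^sup>2) \<le> \<rho> (f b)} \<in> sets ?P"
      using rho by (rule sets_radius_le)
    also have "{f \<in> space ?P. f b \<in> {a..c} \<and> sqrt (\<Sum>i\<in>A. (f i)\<^sup>2) \<le> \<rho> (f b)} = ?T \<inter> space ?P"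
      by blast
    finally show ?thesis .
  qed
  have "emeasure lborel ?S = emeasure (distr (Pi\<^sub>M Basis (\<lambda>_. lborel)) borel (\<lambda>f. \<Sum>k\<in>Basis. f k *\<^sub>R k)) ?S"
    by (simp flip: lborel_eq)
  also have "\<dots> = emeasure (Pi\<^sub>M Basis (\<lambda>_. lborel)) (?T \<inter> space (Pi\<^sub>M Basis (\<lambda>_. lborel)))"
  proof (subst emeasure_distr)
    have "{x \<in> space borel. x \<bullet> b \<in> {a..c} \<and> sqrt (\<Sum>i\<in>A. (x \<bullet> i)\<^sup>2) \<le> \<rho> (x \<bullet> b)} \<in> sets borel"
      using rho by (intro sets_radius_le) measurable
    then show "?S \<in> sets borel" by simp
  qed (simp_all only: pre, measurable)
  also have "\<dots> = emeasure ?P (?T \<inter> space ?P)" by (simp only: A(3))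
  also have "\<dots> = (\<integral>\<^sup>+ f. indicator (?T \<inter> space ?P) f \<partial>?P)"
    using T by simp
  also have "\<dots> = (\<integral>\<^sup>+ y. \<integral>\<^sup>+ x. indicator (?T \<inter> space ?P) (x(b := y)) \<partial>Pi\<^sub>M A (\<lambda>_. lborel) \<partial>lborel)"
    using A T by (subst product_nn_integral_insert_rev) auto
  also have "\<dots> = (\<integral>\<^sup>+ y. indicator {a..c} y * ennreal (unit_ball_vol (real (card A)) * \<rho> y ^ card A) \<partial>lborel)"
  proof (rule nn_integral_cong_AE)
    \<comment> \<open>The two end slices are dropped as a null set since the radius may vanish
      there, while the ball volume formula asks for a positive radius.\<close>
    have "AE y in lborel. y \<notin> {a, c}"
      by (intro AE_not_in countable_imp_null_set_lborel) auto
    then show "AE y in lborel. (\<integral>\<^sup>+ x. indicator (?T \<inter> space ?P) (x(b := y)) \<partial>Pi\<^sub>M A (\<lambda>_. lborel)) =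
        indicator {a..c} y * ennreal (unit_ball_vol (real (card A)) * \<rho> y ^ card A)"
    proof eventually_elim
      case (elim y)
      let ?B = "{f. sqrt (\<Sum>i\<in>A. (f i)\<^sup>2) \<le> \<rho> y} \<inter> space (Pi\<^sub>M A (\<lambda>_. lborel :: real measure))"
      have "(\<integral>\<^sup>+ x. indicator (?T \<inter> space ?P) (x(b := y)) \<partial>Pi\<^sub>M A (\<lambda>_. lborel)) =
          (\<integral>\<^sup>+ x. indicator {a..c} y * indicator ?B x \<partial>Pi\<^sub>M A (\<lambda>_. lborel))"
      proof (rule nn_integral_cong)
        fix x assume x: "x \<in> space (Pi\<^sub>M A (\<lambda>_. lborel :: real measure))"
        have "(\<Sum>i\<in>A. ((x(b := y)) i)\<^sup>2) = (\<Sum>i\<in>A. (x i)\<^sup>2)"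
          using A(2) by (intro sum.cong) auto
        moreover have "x(b := y) \<in> space ?P" using x by (auto simp: space_PiM PiE_def extensional_def)
        ultimately show "indicator (?T \<inter> space ?P) (x(b := y)) = indicator {a..c} y * (indicator ?B x :: ennreal)"
          using x by (simp add: indicator_def)
      qed
      also have "\<dots> = indicator {a..c} y * emeasure (Pi\<^sub>M A (\<lambda>_. lborel)) ?B"
        by (subst nn_integral_cmult) auto
      also have "\<dots> = indicator {a..c} y * ennreal (unit_ball_vol (real (card A)) * \<rho> y ^ card A)"
        using elim pos[of y] by (cases "y \<in> {a..c}") (auto simp: emeasure_cball_aux[OF A(1)])
      finally show ?case .
    qed
  qed
  finally show ?thesis by (simp add: A_def[symmetric] A(4))
qed

text \<open>With h = sin x the integrand becomes cos^4 x, which yields the antiderivative. The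
  square root is not differentiable at 1, hence the fundamental theorem is used in its form for the
  open interval.\<close>

lemma has_integral_cube_sqrt:
  fixes t :: real
  assumes "0 \<le> t" "t \<le> 1"
  shows "((\<lambda>h. sqrt (1 - h\<^sup>2) ^ 3) has_integral
    3 * pi / 16 - (t * (5 - 2 * t\<^sup>2) * sqrt (1 - t\<^sup>2) + 3 * arcsin t) / 8) {t..1}"
proof -
  let ?F = "\<lambda>h::real. (h * (5 - 2 * h\<^sup>2) * sqrt (1 - h\<^sup>2) + 3 * arcsin h) / 8"
  have "((\<lambda>h. sqrt (1 - h\<^sup>2) ^ 3) has_integral ?F 1 - ?F t) {t..1}"
  proof (rule fundamental_theorem_of_calculus_interior)
    show "continuous_on {t..1} ?F"
      using assms by (intro continuous_intros) auto
    fix h assume h: "h \<in> {t<..<1}"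
    then have h1: "h\<^sup>2 < 1" "-1 < h" "h < 1" using assms by (auto simp: power_less_one_iff abs_square_less_1)
    define q where "q = sqrt (1 - h\<^sup>2)"
    have q: "q > 0" "q * q = 1 - h\<^sup>2" using h1 by (auto simp: q_def)
    have dq: "((\<lambda>h. sqrt (1 - h\<^sup>2)) has_real_derivative - h / q) (at h)"
    proof -
      have "((\<lambda>h. 1 - h\<^sup>2) has_real_derivative - (2 * h)) (at h)"
        by (auto intro!: derivative_eq_intros)
      then have "((\<lambda>h. sqrt (1 - h\<^sup>2)) has_real_derivative inverse (sqrt (1 - h\<^sup>2)) / 2 * - (2 * h)) (at h)"
        using h1 by (intro DERIV_chain2[OF DERIV_real_sqrt]) auto
      moreover have "inverse q / 2 * - (2 * h) = - h / q" using q(1) by (simp add: field_simps)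
      ultimately show ?thesis by (simp add: q_def)
    qed
    have da: "(arcsin has_real_derivative 1 / q) (at h)"
      unfolding q_def using DERIV_arcsin[of h] h1 by (simp add: divide_inverse)
    have dp: "((\<lambda>h. h * (5 - 2 * h\<^sup>2)) has_real_derivative 5 - 6 * h\<^sup>2) (at h)"
      by (auto intro!: derivative_eq_intros simp: power2_eq_square)
    have "(?F has_real_derivative
        ((5 - 6 * h\<^sup>2) * sqrt (1 - h\<^sup>2) + - h / q * (h * (5 - 2 * h\<^sup>2)) + 3 * (1 / q)) / 8) (at h)"
      by (intro DERIV_cdivide DERIV_add DERIV_mult DERIV_cmult dq da dp)
    also have "((5 - 6 * h\<^sup>2) * sqrt (1 - h\<^sup>2) + - h / q * (h * (5 - 2 * h\<^sup>2)) + 3 * (1 / q)) / 8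
       = ((5 - 6 * h\<^sup>2) * (q * q) - h\<^sup>2 * (5 - 2 * h\<^sup>2) + 3) / 8 / q"
      unfolding q_def[symmetric] using q(1) by (simp add: field_simps power2_eq_square)
    also have "((5 - 6 * h\<^sup>2) * (q * q) - h\<^sup>2 * (5 - 2 * h\<^sup>2) + 3) / 8 = (q * q) * (q * q)"
      unfolding q(2) by (simp add: field_simps power2_eq_square)
    also have "(q * q) * (q * q) / q = q ^ 3" using q(1) by (simp add: power3_eq_cube)
    finally show "(?F has_vector_derivative sqrt (1 - h\<^sup>2) ^ 3) (at h)"
      by (simp add: q_def has_real_derivative_iff_has_vector_derivative)
  qed (use assms in auto)
  then show ?thesis by (simp add: arcsin_1)
qed

text \<open>The cone over the cap inside the unit ball is a solid of revolution about
  \<open>b\<close>: a straight cone up to height cos r with a piece of the ball on top.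
  \<open>J\<close> is the integral of the cube of its radius function.\<close>

lemma measure_cap_axis:
  assumes b: "b \<in> Basis" and r: "0 < r" "r < pi / 2"
  shows "measure sphere_measure (cap b r) = C r"
proof -
  have cr: "cos r > 0" "sin r > 0" "cos r < 1"
    using r cos_gt_zero_pi[of r] sin_gt_zero[of r] cos_monotone_0_pi[of 0 r] by auto
  have tr: "tan r > 0" using cr by (simp add: tan_def)
  have nb: "norm b = 1" using b by simp
  define \<rho> where "\<rho> h = (if h \<le> cos r then h * tan r else sqrt (1 - h\<^sup>2))" for h :: real
  have rho_m: "\<rho> \<in> borel_measurable borel" unfolding \<rho>_def by measurable
  have rho_pos: "0 < \<rho> h" if "0 < h" "h < 1" for h
    using that tr by (auto simp: \<rho>_def abs_square_less_1)
  let ?S = "{x::real^4. x \<bullet> b \<in> {0..1} \<and> sqrt (\<Sum>i\<in>Basis - {b}. (x \<bullet> i)\<^sup>2) \<le> \<rho> (x \<bullet> b)}"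
  have eq: "x \<in> ?S \<longleftrightarrow> norm x \<le> 1 \<and> cos r * norm x \<le> x \<bullet> b" for x
  proof -
    define h where "h = x \<bullet> b"
    define g where "g = sqrt (\<Sum>i\<in>Basis - {b}. (x \<bullet> i)\<^sup>2)"
    have g0: "g \<ge> 0" by (simp add: g_def sum_nonneg)
    have "(norm x)\<^sup>2 = (\<Sum>i\<in>Basis. (x \<bullet> i)\<^sup>2)"
      unfolding power2_norm_eq_inner by (subst euclidean_inner) (simp add: power2_eq_square)
    also have "\<dots> = h\<^sup>2 + g\<^sup>2"
      using b by (subst sum.remove[of _ b]) (auto simp: h_def g_def sum_nonneg)
    finally have n: "(norm x)\<^sup>2 = h\<^sup>2 + g\<^sup>2" .
    have n1: "norm x \<le> 1 \<longleftrightarrow> h\<^sup>2 + g\<^sup>2 \<le> 1"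
      using n abs_square_le_1[of "norm x"] by simp
    have n2: "cos r * norm x \<le> h \<longleftrightarrow> 0 \<le> h \<and> g \<le> h * tan r"
    proof (cases "0 \<le> h")
      case True
      have "cos r * norm x \<le> h \<longleftrightarrow> (cos r * norm x)\<^sup>2 \<le> h\<^sup>2"
        using True cr by (simp add: power2_le_iff_abs_le abs_mult)
      also have "\<dots> \<longleftrightarrow> (cos r)\<^sup>2 * g\<^sup>2 \<le> (1 - (cos r)\<^sup>2) * h\<^sup>2"
        by (simp add: power_mult_distrib n algebra_simps)
      also have "\<dots> \<longleftrightarrow> (cos r * g)\<^sup>2 \<le> (sin r * h)\<^sup>2"
        by (simp add: power_mult_distrib sin_squared_eq)
      also have "\<dots> \<longleftrightarrow> cos r * g \<le> sin r * h"
        using True cr g0 by (simp add: power2_le_iff_abs_le abs_mult)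
      also have "\<dots> \<longleftrightarrow> g \<le> h * tan r" using cr by (simp add: tan_def field_simps)
      finally show ?thesis using True by simp
    next
      case False
      have "0 \<le> cos r * norm x" using cr by simp
      then have "\<not> cos r * norm x \<le> h" using False by linarith
      then show ?thesis using False by simp
    qed
    \<comment> \<open>Up to height cos r the cone condition implies the ball condition; above it the
      implication is reversed. So one radius bound expresses both.\<close>
    have "h \<in> {0..1} \<and> g \<le> \<rho> h \<longleftrightarrow> h\<^sup>2 + g\<^sup>2 \<le> 1 \<and> 0 \<le> h \<and> g \<le> h * tan r"
    proof (cases "0 \<le> h")
      case h0: True
      show ?thesis
      proof (cases "h \<le> cos r")
        case True
        have "h\<^sup>2 + g\<^sup>2 \<le> 1" if "g \<le> h * tan r"
        proof -
          have "h\<^sup>2 + g\<^sup>2 \<le> h\<^sup>2 + (h * tan r)\<^sup>2" using that g0 by (simp add: power_mono)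
          also have "\<dots> = h\<^sup>2 * (1 + (tan r)\<^sup>2)" by (simp add: power_mult_distrib algebra_simps)
          also have "\<dots> = (h / cos r)\<^sup>2"
            using cr tan_sec[of r] by (simp add: divide_inverse power_inverse power_mult_distrib)
          also have "\<dots> \<le> 1" using True h0 cr by (simp add: power_le_one)
          finally show ?thesis .
        qed
        then show ?thesis using True h0 cr by (auto simp: \<rho>_def)
      next
        case False
        have "g \<le> h * tan r" if "h\<^sup>2 + g\<^sup>2 \<le> 1"
        proof -
          have "(cos r)\<^sup>2 * (h\<^sup>2 + g\<^sup>2) \<le> (cos r)\<^sup>2 * 1" using that by (intro mult_left_mono) auto
          also have "\<dots> \<le> h\<^sup>2" using False cr by (simp add: power_mono)
          finally have "(cos r * norm x)\<^sup>2 \<le> h\<^sup>2" by (simp add: power_mult_distrib n)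
          then have "cos r * norm x \<le> h" using h0 by (rule power2_le_imp_le)
          then show ?thesis using n2 by simp
        qed
        moreover have "h \<le> 1 \<and> g \<le> sqrt (1 - h\<^sup>2) \<longleftrightarrow> h\<^sup>2 + g\<^sup>2 \<le> 1"
        proof
          assume "h \<le> 1 \<and> g \<le> sqrt (1 - h\<^sup>2)"
          moreover from this have "h\<^sup>2 \<le> 1" using h0 by (simp add: power_le_one)
          ultimately have "g\<^sup>2 \<le> 1 - h\<^sup>2" using g0 power_mono[of g "sqrt (1 - h\<^sup>2)" 2] by simp
          then show "h\<^sup>2 + g\<^sup>2 \<le> 1" by simp
        next
          assume *: "h\<^sup>2 + g\<^sup>2 \<le> 1"
          then have "h\<^sup>2 \<le> 1" using zero_le_power2[of g] by linarith
          then show "h \<le> 1 \<and> g \<le> sqrt (1 - h\<^sup>2)"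
            using * h0 abs_square_le_1[of h] by (auto intro!: real_le_rsqrt)
        qed
        ultimately show ?thesis using False h0 by (auto simp: \<rho>_def)
      qed
    qed auto
    then show ?thesis using n1 n2 by (simp add: h_def g_def)
  qed
  have capb: "cap b r = {u \<in> sphere 0 1. cos r \<le> u \<bullet> b}"
    using nb r by (intro cap_eq_inner) auto
  have sec: "sector (cap b r) 1 = ?S - {0}"
  proof (intro set_eqI)
    fix x :: "real^4"
    have "cos r \<le> sgn x \<bullet> b \<longleftrightarrow> cos r * norm x \<le> x \<bullet> b" if "x \<noteq> 0"
      using that by (simp add: sgn_div_norm field_simps)
    then show "x \<in> sector (cap b r) 1 \<longleftrightarrow> x \<in> ?S - {0}"
      unfolding Diff_iff eq by (auto simp: sector_def capb norm_sgn)
  qed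
  define J where "J = cos r * sin r ^ 3 / 4 + (3 * pi / 16 - (cos r * (5 - 2 * (cos r)\<^sup>2) * sin r + 3 * (pi / 2 - r)) / 8)"
  have I: "((\<lambda>h. \<rho> h ^ 3) has_integral J) {0..1}"
    unfolding J_def
  proof (rule has_integral_combine)
    show "0 \<le> cos r" "cos r \<le> 1" using cr by auto
    have "((\<lambda>h. tan r ^ 3 * h ^ 3) has_integral tan r ^ 3 * cos r ^ 4 / 4 - tan r ^ 3 * 0 ^ 4 / 4) {0..cos r}"
      using cr by (intro fundamental_theorem_of_calculus)
        (auto intro!: derivative_eq_intros simp: has_real_derivative_iff_has_vector_derivative[symmetric])
    moreover have "tan r ^ 3 * cos r ^ 4 / 4 - tan r ^ 3 * 0 ^ 4 / 4 = cos r * sin r ^ 3 / 4"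
      using cr by (simp add: tan_def eval_nat_numeral field_simps)
    ultimately have "((\<lambda>h. tan r ^ 3 * h ^ 3) has_integral cos r * sin r ^ 3 / 4) {0..cos r}" by simp
    then show "((\<lambda>h. \<rho> h ^ 3) has_integral cos r * sin r ^ 3 / 4) {0..cos r}"
      by (rule has_integral_eq[rotated]) (auto simp: \<rho>_def power_mult_distrib)
    have s: "sqrt (1 - (cos r)\<^sup>2) = sin r" using cr by (simp flip: sin_squared_eq)
    have a: "arcsin (cos r) = pi / 2 - r"
      using r arcsin_sin[of "pi / 2 - r"] cos_sin_eq[of r] by simp
    have "((\<lambda>h. sqrt (1 - h\<^sup>2) ^ 3) has_integral 3 * pi / 16 - (cos r * (5 - 2 * (cos r)\<^sup>2) * sin r + 3 * (pi / 2 - r)) / 8) {cos r..1}"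
      using has_integral_cube_sqrt[of "cos r"] cr unfolding s a by simp
    then show "((\<lambda>h. \<rho> h ^ 3) has_integral 3 * pi / 16 - (cos r * (5 - 2 * (cos r)\<^sup>2) * sin r + 3 * (pi / 2 - r)) / 8) {cos r..1}"
    proof (rule has_integral_spike_finite[rotated 2, of _ _ _ "{cos r}"])
    qed (auto simp: \<rho>_def)
  qed
  have J: "J = 3 / 8 * (r - cos r * sin r)"
  proof -
    have s3: "sin r ^ 3 = sin r * (1 - (cos r)\<^sup>2)" by (simp add: power3_eq_cube flip: sin_squared_eq power2_eq_square)
    show ?thesis unfolding J_def s3 by (simp add: field_simps power2_eq_square)
  qed
  have rho0: "\<rho> h \<ge> 0" if "h \<in> {0..1}" for h
    using that tr by (auto simp: \<rho>_def power_le_one)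
  have "emeasure lborel (sector (cap b r) 1) = emeasure lborel ?S"
    unfolding sec
    by (rule emeasure_Diff_null_set) (use rho_m in \<open>auto, measurable\<close>)
  also have "\<dots> = (\<integral>\<^sup>+ y. indicator {0..1} y * ennreal (unit_ball_vol 3 * \<rho> y ^ 3) \<partial>lborel)"
    using emeasure_solid_of_revolution[OF b rho_m rho_pos] by simp
  also have "\<dots> = (\<integral>\<^sup>+ y. ennreal (indicator {0..1} y * (4 / 3 * pi * \<rho> y ^ 3)) \<partial>lborel)"
    by (intro nn_integral_cong) (auto simp: indicator_def unit_ball_vol_3)
  also have "\<dots> = ennreal (4 / 3 * pi * J)"
    using rho0 by (intro nn_integral_has_integral_lebesgue has_integral_mult_right I) auto
  finally have "emeasure lborel (sector (cap b r) 1) = ennreal (4 / 3 * pi * J)" .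
  moreover have "J \<ge> 0" using has_integral_nonneg[OF I] rho0 by simp
  ultimately have "measure lborel (sector (cap b r) 1) = 4 / 3 * pi * J"
    by (simp add: measure_def)
  moreover have "cap b r \<in> sets borel" using compact_cap[of b r] nb r by (intro borel_compact) auto
  ultimately have "measure sphere_measure (cap b r) = 16 / 3 * pi * J"
    by (simp add: measure_sector_1[OF _ cap_subset] mult.commute)
  then show ?thesis unfolding C_def sin_double J by (simp add: field_simps)
qed

lemma continuous_C: "continuous_on S C"
  unfolding C_def[abs_def] by (intro continuous_intros)

text \<open>A reflection moves an axis vector to any centre. Radius 0 is not covered by the axial
  formula and is squeezed from above by C s as s tends to 0.\<close>

lemma measure_cap:
  assumes c: "c \<in> sphere 0 1" and r: "0 \<le> r" "r < pi / 2"
  shows "measure sphere_measure (cap c r) = C r"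
proof -
  have pos: "measure sphere_measure (cap c s) = C s" if s: "0 < s" "s < pi / 2" for s
  proof -
    obtain b :: "real^4" where b: "b \<in> Basis" using nonempty_Basis by blast
    have "norm b = norm c" using b c by simp
    then obtain f where f: "orthogonal_transformation f" "f b = c"
      using swapping_reflection_exists by metis
    have "measure sphere_measure (f ` cap b s) = measure sphere_measure (cap b s)"
      using f(1) compact_cap[of b s] b s cap_subset by (intro measure_sphere_orthogonal_image) auto
    then show ?thesis using measure_cap_axis[OF b s] by (simp add: orthogonal_image_cap[OF f(1)] f(2))
  qed
  show ?thesis
  proof (cases "r = 0")
    case True
    have "measure sphere_measure (cap c 0) \<le> 0"
    proof (rule tendsto_lowerbound)
      have "isCont C 0" using continuous_C[of UNIV] by (simp add: continuous_on_eq_continuous_at)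
      then show "(C \<longlongrightarrow> 0) (at_right 0)"
        unfolding isCont_def by (simp add: C_def filterlim_at_split)
      have "\<forall>\<^sub>F s in at_right (0::real). s \<in> {0<..<pi / 2}"
        by (rule eventually_at_right_real) simp
      then show "\<forall>\<^sub>F s in at_right 0. measure sphere_measure (cap c 0) \<le> C s"
      proof eventually_elim
        case (elim s)
        have "measure sphere_measure (cap c 0) \<le> measure sphere_measure (cap c s)"
          using elim c borel_compact[OF compact_cap[of c s]]
          by (intro sphere_measure.finite_measure_mono) (auto simp: cap_def sets_sphere_measure)
        then show ?case using pos[of s] elim by simp
      qed
    qed simp
    then show ?thesis using True measure_nonneg[of sphere_measure "cap c 0"] by (simp add: C_def)
  qed (use pos r in auto)
qed

subsection \<open>Volume of the truncated cell\<close>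

context finite_measure
begin

text \<open>Without triple overlaps, the traces of the earlier sets on the newly added one are
  pairwise disjoint, so the overlap to subtract is a plain sum.\<close>

lemma measure_UN_atMost_double:
  fixes A :: "nat \<Rightarrow> 'a set"
  assumes "\<And>i. A i \<in> sets M"
    and "\<And>i j k. 1 \<le> i \<Longrightarrow> i < j \<Longrightarrow> j < k \<Longrightarrow> k \<le> n \<Longrightarrow> A i \<inter> A j \<inter> A k = {}"
  shows "measure M (\<Union>i\<in>{1..n}. A i) =
    (\<Sum>i=1..n. measure M (A i)) - (\<Sum>j=1..n. \<Sum>i=1..<j. measure M (A i \<inter> A j))"
  using assms(2)
proof (induction n)
  case (Suc n)
  note [measurable] = assms(1)
  let ?U = "\<Union>i\<in>{1..n}. A i" and ?B = "\<lambda>i. A i \<inter> A (Suc n)"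
  have "{1..Suc n} = insert (Suc n) {1..n}" by auto
  then have "(\<Union>i\<in>{1..Suc n}. A i) = ?U \<union> A (Suc n)" by (simp only: UN_insert Un_commute)
  then have "measure M (\<Union>i\<in>{1..Suc n}. A i) = measure M ?U + measure M (A (Suc n)) - measure M (?U \<inter> A (Suc n))"
    using assms(1) by (simp add: measure_Un3 fmeasurable_eq_sets sets.finite_UN)
  also have "?U \<inter> A (Suc n) = (\<Union>i\<in>{1..n}. ?B i)" by blast
  also have "measure M \<dots> = (\<Sum>i=1..n. measure M (?B i))"
  proof (rule finite_measure_finite_Union)
    show "disjoint_family_on ?B {1..n}"
      unfolding disjoint_family_on_def
    proof (intro ballI impI)
      fix i j assume ij: "i \<in> {1..n}" "j \<in> {1..n}" "i \<noteq> j"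
      show "?B i \<inter> ?B j = {}"
      proof (cases "i < j")
        case True
        then have "A i \<inter> A j \<inter> A (Suc n) = {}" using ij by (intro Suc.prems) auto
        then show ?thesis by blast
      next
        case False
        then have "A j \<inter> A i \<inter> A (Suc n) = {}" using ij by (intro Suc.prems) auto
        then show ?thesis by blast
      qed
    qed
  qed auto
  also have "measure M ?U = (\<Sum>i=1..n. measure M (A i)) - (\<Sum>j=1..n. \<Sum>i=1..<j. measure M (A i \<inter> A j))"
    using Suc by simp
  finally show ?case by (simp add: atLeastLessThanSuc_atLeastAtMost)
qed simp

text \<open>Without quadruple overlaps, the traces on the newly added set have no triple overlaps,
  so the pairwise formula applies to them.\<close>

lemma measure_UN_atMost_triple:
  fixes A :: "nat \<Rightarrow> 'a set"
  assumes "\<And>i. A i \<in> sets M"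
    and "\<And>i j k l. 1 \<le> i \<Longrightarrow> i < j \<Longrightarrow> j < k \<Longrightarrow> k < l \<Longrightarrow> l \<le> n \<Longrightarrow> A i \<inter> A j \<inter> A k \<inter> A l = {}"
  shows "measure M (\<Union>i\<in>{1..n}. A i) =
    (\<Sum>i=1..n. measure M (A i)) - (\<Sum>j=1..n. \<Sum>i=1..<j. measure M (A i \<inter> A j)) +
    (\<Sum>k=1..n. \<Sum>j=1..<k. \<Sum>i=1..<j. measure M (A i \<inter> A j \<inter> A k))"
  using assms(2)
proof (induction n)
  case (Suc n)
  note [measurable] = assms(1)
  let ?U = "\<Union>i\<in>{1..n}. A i" and ?B = "\<lambda>i. A i \<inter> A (Suc n)"
  have "{1..Suc n} = insert (Suc n) {1..n}" by auto
  then have "(\<Union>i\<in>{1..Suc n}. A i) = ?U \<union> A (Suc n)" by (simp only: UN_insert Un_commute)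
  then have "measure M (\<Union>i\<in>{1..Suc n}. A i) = measure M ?U + measure M (A (Suc n)) - measure M (?U \<inter> A (Suc n))"
    using assms(1) by (simp add: measure_Un3 fmeasurable_eq_sets sets.finite_UN)
  also have "?U \<inter> A (Suc n) = (\<Union>i\<in>{1..n}. ?B i)" by blast
  also have "measure M \<dots> = (\<Sum>i=1..n. measure M (?B i)) -
      (\<Sum>j=1..n. \<Sum>i=1..<j. measure M (?B i \<inter> ?B j))"
  proof (rule measure_UN_atMost_double)
    fix i j k assume "1 \<le> i" "i < j" "j < k" "k \<le> n"
    then have "A i \<inter> A j \<inter> A k \<inter> A (Suc n) = {}" by (intro Suc.prems) auto
    then show "?B i \<inter> ?B j \<inter> ?B k = {}" by blast
  qed auto
  also have "(\<Sum>j=1..n. \<Sum>i=1..<j. measure M (?B i \<inter> ?B j)) =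
      (\<Sum>j=1..n. \<Sum>i=1..<j. measure M (A i \<inter> A j \<inter> A (Suc n)))"
    by (intro sum.cong refl arg_cong[of _ _ "measure M"]) blast
  also have "measure M ?U = (\<Sum>i=1..n. measure M (A i)) - (\<Sum>j=1..n. \<Sum>i=1..<j. measure M (A i \<inter> A j)) +
      (\<Sum>k=1..n. \<Sum>j=1..<k. \<Sum>i=1..<j. measure M (A i \<inter> A j \<inter> A k))"
    using Suc by simp
  finally show ?case by (simp add: atLeastLessThanSuc_atLeastAtMost)
qed simp

end

lemma sets_cap:
  assumes "c \<in> sphere 0 1" "0 \<le> r" "r < pi / 2"
  shows "cap c r \<in> sets sphere_measure"
  using borel_compact[OF compact_cap[of c r]] assms cap_subset by (auto simp: sets_sphere_measure)

lemma cap_mono: "r \<le> s \<Longrightarrow> cap c r \<subseteq> cap c s"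
  by (auto simp: cap_def)

section \<open>Continuity in the radius\<close>

lemma measure_cap_families_diff:
  assumes F: "finite F" "F \<subseteq> sphere 0 1" and r: "0 \<le> r" "r \<le> s" "s < pi / 2"
    and A: "A \<in> sets sphere_measure" "B \<in> sets sphere_measure" "A \<subseteq> B"
    and sub: "B - A \<subseteq> (\<Union>c\<in>F. cap c s - cap c r)"
  shows "\<bar>measure sphere_measure B - measure sphere_measure A\<bar> \<le> card F * (C s - C r)"
proof -
  have "measure sphere_measure B - measure sphere_measure A = measure sphere_measure (B - A)"
    using A by (simp add: sphere_measure.finite_measure_Diff)
  also have "\<dots> \<le> measure sphere_measure (\<Union>c\<in>F. cap c s - cap c r)"
    using sub F r by (intro sphere_measure.finite_measure_mono) (auto intro!: sets.finite_UN sets.Diff sets_cap)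
  also have "\<dots> \<le> (\<Sum>c\<in>F. measure sphere_measure (cap c s - cap c r))"
    using F r by (intro sphere_measure.finite_measure_subadditive_finite) (auto intro!: sets.Diff sets_cap)
  also have "\<dots> = (\<Sum>c\<in>F. C s - C r)"
  proof (rule sum.cong)
    fix c assume "c \<in> F"
    then have c: "c \<in> sphere 0 1" using F by blast
    have "measure sphere_measure (cap c s - cap c r) = measure sphere_measure (cap c s) - measure sphere_measure (cap c r)"
      using c r by (intro sphere_measure.finite_measure_Diff sets_cap cap_mono) auto
    then show "measure sphere_measure (cap c s - cap c r) = C s - C r"
      using c r by (simp add: measure_cap)
  qed simp
  finally show ?thesis
    using sphere_measure.finite_measure_mono[OF A(3,2)] by simp
qed

text \<open>A uniform argument for unions and intersections of caps: what is gained between two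
  radii lies in the annuli around the finitely many centres, each of measure C s - C r, and
  \<open>C\<close> is continuous.\<close>

lemma continuous_measure_cap_family:
  assumes F: "finite F" "F \<subseteq> sphere 0 1" and R: "R < pi / 2"
    and A: "\<And>r. 0 \<le> r \<Longrightarrow> r < pi / 2 \<Longrightarrow> A r \<in> sets sphere_measure"
    and mono: "\<And>r s. r \<le> s \<Longrightarrow> A r \<subseteq> A s"
    and sub: "\<And>r s. r \<le> s \<Longrightarrow> A s - A r \<subseteq> (\<Union>c\<in>F. cap c s - cap c r)"
  shows "continuous_on {0..R} (\<lambda>r. measure sphere_measure (A r))"
  unfolding continuous_on_def
proof
  fix r assume r: "r \<in> {0..R}"
  let ?m = "\<lambda>r. measure sphere_measure (A r)"
  have le: "\<bar>?m s - ?m r\<bar> \<le> card F * \<bar>C s - C r\<bar>" if s: "s \<in> {0..R}" for s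
  proof -
    have "\<bar>?m y - ?m x\<bar> \<le> card F * \<bar>C y - C x\<bar>" if "0 \<le> x" "x \<le> y" "y \<le> R" for x y
    proof -
      have "\<bar>?m y - ?m x\<bar> \<le> card F * (C y - C x)"
        using that R by (intro measure_cap_families_diff F A mono sub) auto
      also have "\<dots> \<le> card F * \<bar>C y - C x\<bar>" by (intro mult_left_mono) auto
      finally show ?thesis .
    qed
    from this[of r s] this[of s r] show ?thesis using r s by (cases "r \<le> s") (auto simp: abs_minus_commute)
  qed
  have "(C \<longlongrightarrow> C r) (at r within {0..R})"
    using continuous_C[of "{0..R}"] r by (auto simp: continuous_on_def)
  then have "((\<lambda>s. card F * \<bar>C s - C r\<bar>) \<longlongrightarrow> card F * \<bar>C r - C r\<bar>) (at r within {0..R})"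
    by (intro tendsto_intros)
  then have "((\<lambda>s. card F * \<bar>C s - C r\<bar>) \<longlongrightarrow> 0) (at r within {0..R})" by simp
  then have "((\<lambda>s. ?m s - ?m r) \<longlongrightarrow> 0) (at r within {0..R})"
    by (rule Lim_null_comparison[rotated]) (auto simp: eventually_at_filter le)
  then show "(?m \<longlongrightarrow> ?m r) (at r within {0..R})" by (rule LIM_zero_cancel)
qed

section \<open>Growth of the truncated volume\<close>

definition uncovered :: "(real^4) set \<Rightarrow> real \<Rightarrow> (real^4) set" where
  "uncovered W r = sphere 0 1 - (\<Union>w\<in>W. cap w r)"

lemma sets_uncovered:
  assumes "finite W" "W \<subseteq> sphere 0 1" "0 \<le> r" "r < pi / 2"
  shows "(\<Union>w\<in>W. cap w r) \<in> sets sphere_measure" "uncovered W r \<in> sets sphere_measure"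
proof -
  show U: "(\<Union>w\<in>W. cap w r) \<in> sets sphere_measure"
    using assms by (auto intro!: sets.finite_UN sets_cap)
  show "uncovered W r \<in> sets sphere_measure"
    using sets.compl_sets[OF U] by (simp add: uncovered_def space_sphere_measure)
qed

lemma measure_uncovered:
  assumes "finite W" "W \<subseteq> sphere 0 1" "0 \<le> r" "r < pi / 2"
  shows "measure sphere_measure (uncovered W r) = 2 * pi\<^sup>2 - measure sphere_measure (\<Union>w\<in>W. cap w r)"
  using sphere_measure.finite_measure_compl[OF sets_uncovered(1)[OF assms]]
  by (simp add: uncovered_def space_sphere_measure measure_sphere_measure_total)

lemma uncovered_iff:
  assumes "W \<subseteq> sphere 0 1" "0 \<le> r" "r < pi / 2"
  shows "u \<in> uncovered W r \<longleftrightarrow> u \<in> sphere 0 1 \<and> (\<forall>w\<in>W. u \<bullet> w < cos r)"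
proof -
  have "cap w r = {u \<in> sphere 0 1. cos r \<le> u \<bullet> w}" if "w \<in> W" for w
    using that assms by (intro cap_eq_inner) auto
  then show ?thesis by (auto simp: uncovered_def not_le)
qed

definition truncated_vol :: "(real^4) set \<Rightarrow> real \<Rightarrow> real" where
  "truncated_vol W r = vol (cell W \<inter> cball 0 (1 / cos r))"

text \<open>The part of the cell between radii sec r and sec s contains the shell over the
  directions uncovered at \<open>s\<close>, where no constraint is reached before sec s, and lies in
  the shell over those uncovered at \<open>r\<close>, since a point of the cell beyond sec r has its
  direction outside every cap of radius \<open>r\<close>.\<close>

lemma truncated_vol_diff:
  assumes W: "finite W" "W \<subseteq> sphere 0 1" and r: "0 \<le> r" "r \<le> s" "s < pi / 2"
  shows "(1 / cos s ^ 4 - 1 / cos r ^ 4) * measure sphere_measure (uncovered W s) / 4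
      \<le> truncated_vol W s - truncated_vol W r"
    and "truncated_vol W s - truncated_vol W r
      \<le> (1 / cos s ^ 4 - 1 / cos r ^ 4) * measure sphere_measure (uncovered W r) / 4"
proof -
  have cs: "0 < cos s" "cos s \<le> cos r" using r cos_gt_zero_pi[of s] cos_monotone_0_pi_le[of r s] by auto
  have sec: "0 < 1 / cos r" "1 / cos r \<le> 1 / cos s" using cs by (auto simp: frac_le)
  let ?sh = "\<lambda>q. {x. 1 / cos r < norm x \<and> norm x \<le> 1 / cos s \<and> sgn x \<in> uncovered W q}"
  let ?D = "cell W \<inter> cball 0 (1 / cos s) - cball 0 (1 / cos r)"
  have un: "uncovered W q \<in> sets borel" "uncovered W q \<subseteq> sphere 0 1" if "0 \<le> q" "q < pi / 2" for q
    using sets_uncovered(2)[OF W that] by (auto simp: sets_sphere_measure)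
  have sh: "measure lborel (?sh q) = (1 / cos s ^ 4 - 1 / cos r ^ 4) * measure sphere_measure (uncovered W q) / 4"
    if "0 \<le> q" "q < pi / 2" for q
    using measure_shell[OF un[OF that] sec] by (simp add: power_one_over)
  have shs: "?sh q \<in> sets lborel" if "0 \<le> q" "q < pi / 2" for q
  proof -
    note [measurable] = un(1)[OF that]
    show ?thesis by measurable
  qed
  have fin: "emeasure lborel X < \<infinity>" if "X \<subseteq> cball 0 (1 / cos s)" for X :: "(real^4) set"
    using that by (intro emeasure_bounded_finite bounded_subset[OF bounded_cball])
  have D: "?D \<in> sets lborel" using closed_cell by auto
  have "truncated_vol W s - truncated_vol W r = measure lborel ?D"
  proof -
    have "?D = (cell W \<inter> cball 0 (1 / cos s)) - (cell W \<inter> cball 0 (1 / cos r))" by blast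
    moreover have "measure lborel \<dots> = measure lborel (cell W \<inter> cball 0 (1 / cos s)) - measure lborel (cell W \<inter> cball 0 (1 / cos r))"
      using sec closed_cell fin[of "cell W \<inter> cball 0 (1 / cos s)"] by (intro measure_Diff) auto
    ultimately show ?thesis by (simp add: truncated_vol_def vol_def)
  qed
  note eq = this
  have nz: "x \<bullet> w = norm x * (sgn x \<bullet> w)" for x w :: "real^4"
    by (cases "x = 0") (simp_all add: sgn_div_norm)
  have s0: "0 \<le> s" "r < pi / 2" using r by linarith+
  have sub1: "?sh s \<subseteq> ?D"
  proof
    fix x assume x: "x \<in> ?sh s"
    have "x \<bullet> w \<le> 1" if "w \<in> W" for w
    proof -
      have "sgn x \<bullet> w \<le> cos s" using x that uncovered_iff[OF W(2), of s] r by fastforce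
      then have "norm x * (sgn x \<bullet> w) \<le> norm x * cos s" by (intro mult_left_mono) auto
      also have "\<dots> \<le> 1" using x cs by (simp add: field_simps)
      finally show ?thesis by (simp only: nz[of x w])
    qed
    then show "x \<in> ?D" using x by (simp add: cell_def)
  qed
  have sub2: "?D \<subseteq> ?sh r"
  proof
    fix x assume x: "x \<in> ?D"
    then have x1: "1 / cos r < norm x" "norm x \<le> 1 / cos s" by auto
    then have x0: "0 < norm x" using sec by linarith
    have "sgn x \<bullet> w < cos r" if "w \<in> W" for w
    proof -
      have "norm x * (sgn x \<bullet> w) \<le> 1" using x that unfolding nz[symmetric] by (simp add: cell_def)
      also have "1 < norm x * cos r" using x1 cs by (simp add: field_simps)
      finally show ?thesis using x0 by simp
    qed
    then have "sgn x \<in> uncovered W r" using x0 W r by (subst uncovered_iff) (auto simp: norm_sgn)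
    then show "x \<in> ?sh r" using x1 by simp
  qed
  show "(1 / cos s ^ 4 - 1 / cos r ^ 4) * measure sphere_measure (uncovered W s) / 4
      \<le> truncated_vol W s - truncated_vol W r"
  proof -
    have "?D \<in> fmeasurable lborel" using D fin[of ?D] by (intro fmeasurableI) auto
    moreover have "?sh s \<in> sets lborel" using s0(1) r(3) by (rule shs)
    ultimately have "measure lborel (?sh s) \<le> measure lborel ?D"
      using sub1 by (intro measure_mono_fmeasurable)
    then show ?thesis unfolding eq sh[OF s0(1) r(3)] .
  qed
  show "truncated_vol W s - truncated_vol W r
      \<le> (1 / cos s ^ 4 - 1 / cos r ^ 4) * measure sphere_measure (uncovered W r) / 4"
  proof -
    have "?sh r \<in> sets lborel" using r(1) s0(2) by (rule shs)
    then have "?sh r \<in> fmeasurable lborel"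
      by (rule fmeasurableI) (rule fin, force)
    then have "measure lborel ?D \<le> measure lborel (?sh r)"
      by (rule measure_mono_fmeasurable[OF sub2 D])
    then show ?thesis unfolding eq sh[OF r(1) s0(2)] .
  qed
qed

lemma continuous_sec4_deriv:
  assumes "R < pi / 2"
  shows "continuous_on {0..R} (\<lambda>r::real. 4 * sin r / cos r ^ 5)"
proof (intro continuous_intros ballI)
  fix r :: real assume "r \<in> {0..R}"
  then show "cos r ^ 5 \<noteq> 0" using assms cos_gt_zero_pi[of r] by auto
qed

lemma continuous_measure_uncovered:
  assumes W: "finite W" "W \<subseteq> sphere 0 1" and R: "R < pi / 2"
  shows "continuous_on {0..R} (\<lambda>r. measure sphere_measure (uncovered W r))"
proof -
  have "continuous_on {0..R} (\<lambda>r. measure sphere_measure (\<Union>w\<in>W. cap w r))"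
  proof (rule continuous_measure_cap_family[OF W R])
    show "(\<Union>w\<in>W. cap w r) \<subseteq> (\<Union>w\<in>W. cap w s)" if "r \<le> s" for r s
      using cap_mono[OF that] by (intro UN_mono) auto
    show "(\<Union>w\<in>W. cap w s) - (\<Union>w\<in>W. cap w r) \<subseteq> (\<Union>w\<in>W. cap w s - cap w r)" for r s
      by blast
  qed (rule sets_uncovered(1)[OF W])
  then have "continuous_on {0..R} (\<lambda>r. 2 * pi\<^sup>2 - measure sphere_measure (\<Union>w\<in>W. cap w r))"
    by (intro continuous_intros)
  then show ?thesis
    by (rule continuous_on_eq) (use measure_uncovered[OF W] R in auto)
qed

text \<open>The truncated volume grows at the rate at which the uncovered directions sweep out volume:
  both one-sided bounds of the previous lemma agree to first order.\<close>

lemma has_derivative_truncated_vol: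
  assumes W: "finite W" "W \<subseteq> sphere 0 1" and R: "R < pi / 2" and r: "r \<in> {0..R}"
  shows "(truncated_vol W has_real_derivative
    measure sphere_measure (uncovered W r) * (4 * sin r / cos r ^ 5) / 4) (at r within {0..R})"
proof -
  let ?m = "\<lambda>r. measure sphere_measure (uncovered W r)"
  let ?s = "\<lambda>r::real. 1 / cos r ^ 4"
  let ?g = "truncated_vol W"
  let ?F = "at r within {0..R}"
  let ?Q = "\<lambda>y. (?s y - ?s r) / (y - r)"
  \<comment> \<open>Letting \<open>z\<close> be either end of the interval makes one estimate serve
    difference quotients from the right and from the left. The error is the increment of sec^4 times
    a change of uncovered measure that tends to 0.\<close>
  have bound: "\<bar>(?g y - ?g x) - (?s y - ?s x) * ?m z / 4\<bar> \<le> \<bar>(?s y - ?s x) / 4\<bar> * \<bar>?m y - ?m x\<bar>"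
    if xy: "0 \<le> x" "x \<le> y" "y \<le> R" and z: "z = x \<or> z = y" for x y z
  proof -
    have cs: "0 < cos y" "cos y \<le> cos x"
      using xy R cos_gt_zero_pi[of y] cos_monotone_0_pi_le[of x y] by auto
    have s: "0 \<le> ?s y - ?s x" using cs by (simp add: frac_le power_mono)
    have "(?s y - ?s x) * ?m y / 4 \<le> ?g y - ?g x" "?g y - ?g x \<le> (?s y - ?s x) * ?m x / 4"
      using truncated_vol_diff[OF W, of x y] xy R by auto
    moreover have "\<bar>(?s y - ?s x) / 4\<bar> * \<bar>?m y - ?m x\<bar> \<ge> (?s y - ?s x) * ?m x / 4 - (?s y - ?s x) * ?m y / 4"
    proof -
      have "(?s y - ?s x) * ?m x / 4 - (?s y - ?s x) * ?m y / 4 = (?s y - ?s x) / 4 * (?m x - ?m y)"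
        by (simp add: algebra_simps diff_divide_distrib)
      also have "\<dots> \<le> \<bar>(?s y - ?s x) / 4 * (?m x - ?m y)\<bar>" by (rule abs_ge_self)
      also have "\<dots> = \<bar>(?s y - ?s x) / 4\<bar> * \<bar>?m y - ?m x\<bar>"
        unfolding abs_mult by (simp only: abs_minus_commute[of "?m x"])
      finally show ?thesis .
    qed
    ultimately show ?thesis using z by (auto simp only: abs_le_iff) linarith+
  qed
  have bound': "\<bar>(?g y - ?g r) - (?s y - ?s r) * ?m r / 4\<bar> \<le> \<bar>(?s y - ?s r) / 4\<bar> * \<bar>?m y - ?m r\<bar>"
    if y: "y \<in> {0..R}" for y
  proof (cases "r \<le> y")
    case True
    then show ?thesis using bound[of r y r] r y by simp
  next
    case False
    have "(?g r - ?g y) - (?s r - ?s y) * ?m r / 4 = - ((?g y - ?g r) - (?s y - ?s r) * ?m r / 4)"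
      by (simp add: algebra_simps diff_divide_distrib)
    then have 1: "\<bar>(?g r - ?g y) - (?s r - ?s y) * ?m r / 4\<bar> = \<bar>(?g y - ?g r) - (?s y - ?s r) * ?m r / 4\<bar>"
      by (simp only: abs_minus_cancel)
    have 2: "\<bar>(?s r - ?s y) / 4\<bar> * \<bar>?m r - ?m y\<bar> = \<bar>(?s y - ?s r) / 4\<bar> * \<bar>?m y - ?m r\<bar>"
      by (simp add: abs_minus_commute)
    have "0 \<le> y" "y \<le> r" "r \<le> R" using r y False by auto
    from bound[OF this, of r] show ?thesis unfolding 1 2 by simp
  qed
  have "cos r \<noteq> 0" using r R cos_gt_zero_pi[of r] by auto
  then have "(?s has_real_derivative 4 * sin r / cos r ^ 5) ?F"
    by (intro DERIV_subset[OF deriv_sec4]) auto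
  then have Q: "(?Q \<longlongrightarrow> 4 * sin r / cos r ^ 5) ?F"
    by (simp add: has_field_derivative_iff)
  have m: "(?m \<longlongrightarrow> ?m r) ?F"
    using continuous_measure_uncovered[OF W R] r by (auto simp: continuous_on_def)
  have "((\<lambda>y. \<bar>?Q y / 4\<bar> * \<bar>?m y - ?m r\<bar>) \<longlongrightarrow> \<bar>4 * sin r / cos r ^ 5 / 4\<bar> * \<bar>?m r - ?m r\<bar>) ?F"
    by (rule tendsto_mult[OF tendsto_rabs[OF tendsto_divide[OF Q tendsto_const]]
          tendsto_rabs[OF tendsto_diff[OF m tendsto_const]]]) simp
  then have lim0: "((\<lambda>y. \<bar>?Q y / 4\<bar> * \<bar>?m y - ?m r\<bar>) \<longlongrightarrow> 0) ?F" by simp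
  have gen: "a / b - c / b * d / 4 = (a - c * d / 4) / b" for a b c d :: real
    by (simp add: diff_divide_distrib)
  have "((\<lambda>y. (?g y - ?g r) / (y - r) - ?Q y * ?m r / 4) \<longlongrightarrow> 0) ?F"
  proof (rule Lim_null_comparison[OF _ lim0])
    have "norm ((?g y - ?g r) / (y - r) - ?Q y * ?m r / 4) \<le> \<bar>?Q y / 4\<bar> * \<bar>?m y - ?m r\<bar>"
      if y: "y \<in> {0..R}" "y \<noteq> r" for y
    proof -
      have "(?g y - ?g r) / (y - r) - ?Q y * ?m r / 4 = ((?g y - ?g r) - (?s y - ?s r) * ?m r / 4) / (y - r)"
        by (rule gen)
      then have "norm ((?g y - ?g r) / (y - r) - ?Q y * ?m r / 4) =
          \<bar>(?g y - ?g r) - (?s y - ?s r) * ?m r / 4\<bar> / \<bar>y - r\<bar>"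
        by (simp only: real_norm_def abs_divide)
      also have "\<dots> \<le> \<bar>(?s y - ?s r) / 4\<bar> * \<bar>?m y - ?m r\<bar> / \<bar>y - r\<bar>"
        using bound'[OF y(1)] by (intro divide_right_mono) auto
      also have "\<dots> = \<bar>?Q y / 4\<bar> * \<bar>?m y - ?m r\<bar>" by (simp only: abs_divide) simp
      finally show ?thesis .
    qed
    then show "\<forall>\<^sub>F y in ?F. norm ((?g y - ?g r) / (y - r) - ?Q y * ?m r / 4) \<le> \<bar>?Q y / 4\<bar> * \<bar>?m y - ?m r\<bar>"
      by (auto simp: eventually_at_filter)
  qed
  moreover have "((\<lambda>y. ?Q y * ?m r / 4) \<longlongrightarrow> (4 * sin r / cos r ^ 5) * ?m r / 4) ?F"
    by (rule tendsto_divide[OF tendsto_mult[OF Q tendsto_const] tendsto_const]) simp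
  ultimately have "((\<lambda>y. ((?g y - ?g r) / (y - r) - ?Q y * ?m r / 4) + ?Q y * ?m r / 4) \<longlongrightarrow>
      0 + (4 * sin r / cos r ^ 5) * ?m r / 4) ?F"
    by (rule tendsto_add)
  then have "((\<lambda>y. (?g y - ?g r) / (y - r)) \<longlongrightarrow> ?m r * (4 * sin r / cos r ^ 5) / 4) ?F"
    by (simp only: diff_add_cancel add_0_left mult.commute[of "?m r"])
  then show ?thesis by (simp only: has_field_derivative_iff)
qed

text \<open>Integrates the derivative from radius 0, where the ball of radius sec 0 = 1 lies in the
  cell and contributes its volume pi^2 / 2.\<close>

lemma truncated_vol_eq:
  assumes W: "finite W" "W \<subseteq> sphere 0 1" and R: "0 \<le> R" "R < pi / 2"
  shows "truncated_vol W R = 1 / 4 * (2 * pi\<^sup>2 +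
    integral {0..R} (\<lambda>r. measure sphere_measure (uncovered W r) * (4 * sin r / cos r ^ 5)))"
proof -
  let ?f = "\<lambda>r. measure sphere_measure (uncovered W r) * (4 * sin r / cos r ^ 5)"
  have "((\<lambda>r. ?f r / 4) has_integral truncated_vol W R - truncated_vol W 0) {0..R}"
    using has_derivative_truncated_vol[OF W R(2)] R(1)
    by (intro fundamental_theorem_of_calculus) (auto simp: has_real_derivative_iff_has_vector_derivative)
  from integral_unique[OF this] have "integral {0..R} ?f / 4 = truncated_vol W R - truncated_vol W 0"
    by (simp only: integral_divide)
  moreover have "truncated_vol W 0 = pi\<^sup>2 / 2"
  proof -
    have "cell W \<inter> cball 0 1 = cball 0 1" using cball_subset_cell[OF W(2)] by blast
    then show ?thesis by (simp add: truncated_vol_def vol_def content_cball unit_ball_vol_4)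
  qed
  ultimately show ?thesis by (simp add: field_simps)
qed

section \<open>Overlap thresholds and the volume decompositions\<close>

text \<open>A common point \<open>u\<close> satisfies 3 cos r <= u . S <= sqrt 6, so cos r is at
  most sqrt (2/3) = cos \<open>r_star\<close>. The bound on \<open>r\<close> is strict because three
  caps with centres pairwise at pi / 3 meet in a point at \<open>r_star\<close>.\<close>

lemma no_triple_overlap:
  assumes W: "contact_config W" "a \<in> W" "b \<in> W" "c \<in> W" "distinct [a, b, c]"
    and r: "0 \<le> r" "r < r_star"
  shows "cap a r \<inter> cap b r \<inter> cap c r = {}"
proof (rule ccontr)
  assume "cap a r \<inter> cap b r \<inter> cap c r \<noteq> {}"
  then obtain u where u: "u \<in> cap a r" "u \<in> cap b r" "u \<in> cap c r" by blast
  have sph: "a \<in> sphere 0 1" "b \<in> sphere 0 1" "c \<in> sphere 0 1" using W by (auto simp: contact_config_def)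
  have ui: "cos r \<le> u \<bullet> a" "cos r \<le> u \<bullet> b" "cos r \<le> u \<bullet> c" and nu: "norm u = 1"
    using u sph r r_star_bounds by (auto simp: cap_eq_inner)
  define S where "S = a + b + c"
  have half: "a \<bullet> b \<le> 1 / 2" "a \<bullet> c \<le> 1 / 2" "b \<bullet> c \<le> 1 / 2"
    using inner_le_half[OF W(1)] W by auto
  have "S \<bullet> S = 3 + 2 * (a \<bullet> b + a \<bullet> c + b \<bullet> c)"
    using inner_self_one[OF W(1)] W
    by (simp add: S_def inner_add_left inner_add_right inner_commute[of b a] inner_commute[of c a] inner_commute[of c b])
  also have "\<dots> \<le> 3 + 2 * (1 / 2 + 1 / 2 + 1 / 2)"
    by (intro add_mono mult_left_mono half order_refl) simp
  finally have SS: "(norm S)\<^sup>2 \<le> 6" by (simp add: power2_norm_eq_inner)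
  have "cos r_star < cos r" using r r_star_bounds by (intro cos_monotone_0_pi) auto
  moreover have "0 < cos r_star" by (simp add: cos_r_star)
  ultimately have "(cos r_star)\<^sup>2 < (cos r)\<^sup>2" by (intro power_strict_mono) auto
  then have c2: "2 / 3 < (cos r)\<^sup>2" by (simp add: cos_r_star power_divide)
  have "cos r + cos r + cos r \<le> u \<bullet> a + u \<bullet> b + u \<bullet> c" by (intro add_mono ui)
  also have "\<dots> = u \<bullet> S" by (simp add: S_def inner_add_right)
  also have "\<dots> \<le> norm S" using norm_cauchy_schwarz[of u S] nu by simp
  finally have "(3 * cos r)\<^sup>2 \<le> (norm S)\<^sup>2"
    using \<open>cos r_star < cos r\<close> \<open>0 < cos r_star\<close> by (intro power_mono) auto
  then show False using SS c2 by (simp add: power_mult_distrib)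
qed

lemma no_quadruple_overlap:
  assumes W: "contact_config W" "a \<in> W" "b \<in> W" "c \<in> W" "d \<in> W" "distinct [a, b, c, d]"
    and r: "0 \<le> r" "r < r_4"
  shows "cap a r \<inter> cap b r \<inter> cap c r \<inter> cap d r = {}"
proof (rule ccontr)
  assume "cap a r \<inter> cap b r \<inter> cap c r \<inter> cap d r \<noteq> {}"
  then obtain u where u: "u \<in> cap a r" "u \<in> cap b r" "u \<in> cap c r" "u \<in> cap d r" by blast
  have sph: "a \<in> sphere 0 1" "b \<in> sphere 0 1" "c \<in> sphere 0 1" "d \<in> sphere 0 1"
    using W by (auto simp: contact_config_def)
  have ui: "cos r \<le> u \<bullet> a" "cos r \<le> u \<bullet> b" "cos r \<le> u \<bullet> c" "cos r \<le> u \<bullet> d" and nu: "norm u = 1"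
    using u sph r r_4_bounds by (auto simp: cap_eq_inner)
  define S where "S = a + b + c + d"
  have SS: "(norm S)\<^sup>2 \<le> 10"
    using norm_sum_four_le[OF W] by (simp add: S_def)
  have "cos r_4 < cos r" using r r_4_bounds by (intro cos_monotone_0_pi) auto
  moreover have "0 < cos r_4" by (simp add: cos_r_4)
  ultimately have "(cos r_4)\<^sup>2 < (cos r)\<^sup>2" by (intro power_strict_mono) auto
  then have c2: "5 / 8 < (cos r)\<^sup>2" by (simp add: cos_r_4)
  have "cos r + cos r + cos r + cos r \<le> u \<bullet> a + u \<bullet> b + u \<bullet> c + u \<bullet> d" by (intro add_mono ui)
  also have "\<dots> = u \<bullet> S" by (simp add: S_def inner_add_right)
  also have "\<dots> \<le> norm S" using norm_cauchy_schwarz[of u S] nu by simp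
  finally have "(4 * cos r)\<^sup>2 \<le> (norm S)\<^sup>2"
    using \<open>cos r_4 < cos r\<close> \<open>0 < cos r_4\<close> by (intro power_mono) auto
  then show False using SS c2 by (simp add: power_mult_distrib)
qed

lemma continuous_measure_cap_Int:
  assumes F: "finite F" "F \<noteq> {}" "F \<subseteq> sphere 0 1" and R: "R < pi / 2"
  shows "continuous_on {0..R} (\<lambda>r. measure sphere_measure (\<Inter>c\<in>F. cap c r))"
proof (rule continuous_measure_cap_family[of F])
  show "(\<Inter>c\<in>F. cap c r) \<in> sets sphere_measure" if "0 \<le> r" "r < pi / 2" for r
    using F that sets_cap by (intro sets.finite_INT) auto
  show "(\<Inter>c\<in>F. cap c r) \<subseteq> (\<Inter>c\<in>F. cap c s)" if "r \<le> s" for r s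
    using cap_mono[OF that] by blast
  show "(\<Inter>c\<in>F. cap c s) - (\<Inter>c\<in>F. cap c r) \<subseteq> (\<Union>c\<in>F. cap c s - cap c r)" for r s
    by blast
qed (use F R in auto)

text \<open>An identity rather than an estimate, since inclusion-exclusion is exact below the
  threshold; this is why the pair inequality is equivalent to the bound on the truncated
  volume.\<close>

lemma config_decomposition_double:
  assumes w: "config23 w"
  shows "vol (cell (w ` {1..23}) \<inter> cball 0 (sqrt (3 / 2))) = A_star + pair_sum omega w"
proof -
  let ?W = "w ` {1..23}" and ?R = r_star
  let ?d = "\<lambda>r::real. 4 * sin r / cos r ^ 5"
  let ?L = "\<lambda>i j r. measure sphere_measure (cap (w i) r \<inter> cap (w j) r)"
  have inj: "inj_on w {1..23}" and cc: "contact_config ?W" using w by (auto simp: config23_def)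
  have W: "finite ?W" "?W \<subseteq> sphere 0 1" using cc by (auto simp: contact_config_def)
  have R: "0 \<le> ?R" "?R < pi / 2" using r_star_bounds by auto
  have sph: "w i \<in> sphere 0 1" if "i \<in> {1..23}" for i using W that by blast
  have sec: "1 / cos ?R = sqrt (3 / 2)" by (simp add: cos_r_star real_sqrt_divide)
  have unc: "measure sphere_measure (uncovered ?W r) =
      (2 * pi\<^sup>2 - 23 * C r) + (\<Sum>j=1..23. \<Sum>i=1..<j. ?L i j r)" if r: "0 \<le> r" "r < ?R" for r
  proof -
    \<comment> \<open>Nothing is known of \<open>w\<close> outside the index range, but
      inclusion-exclusion asks for measurability at every index; the empty set fills the
      gap.\<close>
    let ?A = "\<lambda>i. if i \<in> {1..23} then cap (w i) r else {}"
    have U: "(\<Union>v\<in>?W. cap v r) = (\<Union>i\<in>{1..23}. ?A i)" by auto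
    have r2: "r < pi / 2" using r R by simp
    have "measure sphere_measure (\<Union>i\<in>{1..23}. ?A i) = (\<Sum>i=1..23. measure sphere_measure (?A i)) -
        (\<Sum>j=1..23. \<Sum>i=1..<j. measure sphere_measure (?A i \<inter> ?A j))"
    proof (rule sphere_measure.measure_UN_atMost_double)
      show "?A i \<in> sets sphere_measure" for i using sph r r2 sets_cap by simp
      fix i j k :: nat assume ijk: "1 \<le> i" "i < j" "j < k" "k \<le> 23"
      have "w i \<noteq> w j" "w i \<noteq> w k" "w j \<noteq> w k"
        using inj ijk by (auto dest!: inj_onD)
      then have "cap (w i) r \<inter> cap (w j) r \<inter> cap (w k) r = {}"
        using ijk r by (intro no_triple_overlap[OF cc]) auto
      then show "?A i \<inter> ?A j \<inter> ?A k = {}" using ijk by auto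
    qed
    also have "(\<Sum>i=1..23. measure sphere_measure (?A i)) = (\<Sum>i\<in>{1..23::nat}. C r)"
      using sph r r2 by (intro sum.cong) (auto simp: measure_cap)
    also have "\<dots> = 23 * C r" by simp
    also have "(\<Sum>j=1..23. \<Sum>i=1..<j. measure sphere_measure (?A i \<inter> ?A j)) = (\<Sum>j=1..23. \<Sum>i=1..<j. ?L i j r)"
      by (intro sum.cong refl) auto
    finally show ?thesis using measure_uncovered[OF W r(1) r2] U by simp
  qed
  have cd: "continuous_on {0..?R} ?d" using R by (intro continuous_sec4_deriv)
  have cL: "continuous_on {0..?R} (\<lambda>r. ?L i j r * ?d r)" if "i \<in> {1..23}" "j \<in> {1..23}" for i j
    using continuous_measure_cap_Int[of "{w i, w j}" ?R] that sph R cd by (intro continuous_on_mult) auto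
  have c1: "continuous_on {0..?R} (\<lambda>r. (2 * pi\<^sup>2 - 23 * C r) * ?d r)"
    by (intro continuous_intros continuous_C cd)
  have om: "integral {0..?R} (\<lambda>r. ?L i j r * ?d r) = 4 * omega (angle (w i) (w j))"
    if "i \<in> {1..23}" "j \<in> {1..23}" for i j
  proof -
    have "sec4_integral ?R (\<lambda>r. Lam r (angle (w i) (w j))) = integral {0..?R} (\<lambda>r. ?L i j r * ?d r)"
      unfolding sec4_integral_eq[OF R] using sph that R by (intro integral_cong) (auto simp: Lam_eq)
    then show ?thesis by (simp add: omega_def)
  qed
  have "integral {0..?R} (\<lambda>r. measure sphere_measure (uncovered ?W r) * ?d r) =
      integral {0..?R} (\<lambda>r. (2 * pi\<^sup>2 - 23 * C r) * ?d r + (\<Sum>j=1..23. \<Sum>i=1..<j. ?L i j r * ?d r))"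
  \<comment> \<open>The overlap bound holds only for radii strictly below \<open>r_star\<close>; the
    end point is negligible for the integral.\<close>
  proof (rule integral_spike[of "{?R}"])
    fix r assume "r \<in> {0..?R} - {?R}"
    then have "measure sphere_measure (uncovered ?W r) =
      (2 * pi\<^sup>2 - 23 * C r) + (\<Sum>j=1..23. \<Sum>i=1..<j. ?L i j r)" by (intro unc) auto
    then show "(2 * pi\<^sup>2 - 23 * C r) * ?d r + (\<Sum>j=1..23. \<Sum>i=1..<j. ?L i j r * ?d r) =
        measure sphere_measure (uncovered ?W r) * ?d r"
      by (simp only: distrib_right sum_distrib_right)
  qed simp
  also have "\<dots> = integral {0..?R} (\<lambda>r. (2 * pi\<^sup>2 - 23 * C r) * ?d r) +
      integral {0..?R} (\<lambda>r. \<Sum>j=1..23. \<Sum>i=1..<j. ?L i j r * ?d r)"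
    using c1 cL by (intro integral_add integrable_continuous_real continuous_on_sum) auto
  also have "integral {0..?R} (\<lambda>r. \<Sum>j=1..23. \<Sum>i=1..<j. ?L i j r * ?d r) =
      (\<Sum>j=1..23. integral {0..?R} (\<lambda>r. \<Sum>i=1..<j. ?L i j r * ?d r))"
    using cL by (intro integral_sum integrable_continuous_real continuous_on_sum) auto
  also have "\<dots> = (\<Sum>j=1..23. \<Sum>i=1..<j. integral {0..?R} (\<lambda>r. ?L i j r * ?d r))"
    using cL by (intro sum.cong refl integral_sum integrable_continuous_real) auto
  also have "\<dots> = (\<Sum>j=1..23. \<Sum>i=1..<j. 4 * omega (angle (w i) (w j)))"
    by (intro sum.cong refl om) auto
  also have "\<dots> = 4 * pair_sum omega w" by (simp add: pair_sum_def sum_distrib_left)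
  also have "integral {0..?R} (\<lambda>r. (2 * pi\<^sup>2 - 23 * C r) * ?d r) = sec4_integral ?R (\<lambda>r. 2 * pi\<^sup>2 - 23 * C r)"
    by (simp add: sec4_integral_eq[OF R])
  finally have "truncated_vol ?W ?R = A_star + pair_sum omega w"
    unfolding truncated_vol_eq[OF W R] A_star_def by (simp add: algebra_simps)
  then show ?thesis unfolding truncated_vol_def sec .
qed

text \<open>Up to \<open>r_4\<close> triple overlaps can occur but quadruple ones cannot, so the
  exact formula gains the triple sum, negative because the uncovered measure is the complement of
  the union.\<close>

lemma config_decomposition_triple:
  assumes w: "config23 w"
  shows "vol (cell (w ` {1..23}) \<inter> cball 0 (sqrt (8 / 5))) = A_4 + pair_sum omega_4 w - triple_sum omega_3 w"
proof -
  let ?W = "w ` {1..23}" and ?R = r_4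
  let ?d = "\<lambda>r::real. 4 * sin r / cos r ^ 5"
  let ?T = "\<lambda>i j k r. measure sphere_measure (cap (w i) r \<inter> cap (w j) r \<inter> cap (w k) r)"
  let ?L = "\<lambda>i j r. measure sphere_measure (cap (w i) r \<inter> cap (w j) r)"
  have inj: "inj_on w {1..23}" and cc: "contact_config ?W" using w by (auto simp: config23_def)
  have W: "finite ?W" "?W \<subseteq> sphere 0 1" using cc by (auto simp: contact_config_def)
  have R: "0 \<le> ?R" "?R < pi / 2" using r_4_bounds by auto
  have sph: "w i \<in> sphere 0 1" if "i \<in> {1..23}" for i using W that by blast
  have sec: "1 / cos ?R = sqrt (8 / 5)" by (simp add: cos_r_4 real_sqrt_divide)
  have unc: "measure sphere_measure (uncovered ?W r) =
      (2 * pi\<^sup>2 - 23 * C r) + (\<Sum>j=1..23. \<Sum>i=1..<j. ?L i j r) -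
      (\<Sum>k=1..23. \<Sum>j=1..<k. \<Sum>i=1..<j. ?T i j k r)" if r: "0 \<le> r" "r < ?R" for r
  proof -
    let ?A = "\<lambda>i. if i \<in> {1..23} then cap (w i) r else {}"
    have U: "(\<Union>v\<in>?W. cap v r) = (\<Union>i\<in>{1..23}. ?A i)" by auto
    have r2: "r < pi / 2" using r R by simp
    have "measure sphere_measure (\<Union>i\<in>{1..23}. ?A i) = (\<Sum>i=1..23. measure sphere_measure (?A i)) -
        (\<Sum>j=1..23. \<Sum>i=1..<j. measure sphere_measure (?A i \<inter> ?A j)) +
        (\<Sum>k=1..23. \<Sum>j=1..<k. \<Sum>i=1..<j. measure sphere_measure (?A i \<inter> ?A j \<inter> ?A k))"
    proof (rule sphere_measure.measure_UN_atMost_triple)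
      show "?A i \<in> sets sphere_measure" for i using sph r r2 sets_cap by simp
      fix i j k l :: nat assume ijk: "1 \<le> i" "i < j" "j < k" "k < l" "l \<le> 23"
      have "w p \<noteq> w q" if "p \<in> {i, j, k, l}" "q \<in> {i, j, k, l}" "p \<noteq> q" for p q
        using inj_onD[OF inj, of p q] that ijk by auto
      then have "distinct [w i, w j, w k, w l]" using ijk by auto
      then have "cap (w i) r \<inter> cap (w j) r \<inter> cap (w k) r \<inter> cap (w l) r = {}"
        using ijk r by (intro no_quadruple_overlap[OF cc]) auto
      then show "?A i \<inter> ?A j \<inter> ?A k \<inter> ?A l = {}" using ijk by auto
    qed
    also have "(\<Sum>i=1..23. measure sphere_measure (?A i)) = (\<Sum>i\<in>{1..23::nat}. C r)"
      using sph r r2 by (intro sum.cong) (auto simp: measure_cap)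
    also have "\<dots> = 23 * C r" by simp
    also have "(\<Sum>j=1..23. \<Sum>i=1..<j. measure sphere_measure (?A i \<inter> ?A j)) = (\<Sum>j=1..23. \<Sum>i=1..<j. ?L i j r)"
      by (intro sum.cong refl) auto
    also have "(\<Sum>k=1..23. \<Sum>j=1..<k. \<Sum>i=1..<j. measure sphere_measure (?A i \<inter> ?A j \<inter> ?A k)) =
        (\<Sum>k=1..23. \<Sum>j=1..<k. \<Sum>i=1..<j. ?T i j k r)"
      by (intro sum.cong refl) auto
    finally show ?thesis using measure_uncovered[OF W r(1) r2] U by simp
  qed
  have cd: "continuous_on {0..?R} ?d" using R by (intro continuous_sec4_deriv)
  have cL: "continuous_on {0..?R} (\<lambda>r. ?L i j r * ?d r)" if "i \<in> {1..23}" "j \<in> {1..23}" for i j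
    using continuous_measure_cap_Int[of "{w i, w j}" ?R] that sph R cd by (intro continuous_on_mult) auto
  have cT: "continuous_on {0..?R} (\<lambda>r. ?T i j k r * ?d r)"
    if "i \<in> {1..23}" "j \<in> {1..23}" "k \<in> {1..23}" for i j k
    using continuous_measure_cap_Int[of "{w i, w j, w k}" ?R] that sph R cd
    by (intro continuous_on_mult) (auto simp: Int_assoc)
  have c1: "continuous_on {0..?R} (\<lambda>r. (2 * pi\<^sup>2 - 23 * C r) * ?d r)"
    by (intro continuous_intros continuous_C cd)
  have om: "integral {0..?R} (\<lambda>r. ?L i j r * ?d r) = 4 * omega_4 (angle (w i) (w j))"
    if "i \<in> {1..23}" "j \<in> {1..23}" for i j
  proof -
    have "sec4_integral ?R (\<lambda>r. Lam r (angle (w i) (w j))) = integral {0..?R} (\<lambda>r. ?L i j r * ?d r)"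
      unfolding sec4_integral_eq[OF R] using sph that R by (intro integral_cong) (auto simp: Lam_eq)
    then show ?thesis by (simp add: omega_4_def)
  qed
  have om3: "integral {0..?R} (\<lambda>r. ?T i j k r * ?d r) =
      4 * omega_3 (angle (w i) (w j)) (angle (w i) (w k)) (angle (w j) (w k))"
    if "i \<in> {1..23}" "j \<in> {1..23}" "k \<in> {1..23}" for i j k
  proof -
    have "sec4_integral ?R (\<lambda>r. Lam3 r (angle (w i) (w j)) (angle (w i) (w k)) (angle (w j) (w k))) =
        integral {0..?R} (\<lambda>r. ?T i j k r * ?d r)"
      unfolding sec4_integral_eq[OF R] using sph that R by (intro integral_cong) (auto simp: Lam3_eq)
    then show ?thesis by (simp add: omega_3_def)
  qed
  have pairs: "integral {0..?R} (\<lambda>r. \<Sum>j=1..23. \<Sum>i=1..<j. ?L i j r * ?d r) = 4 * pair_sum omega_4 w"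
  proof -
    have "integral {0..?R} (\<lambda>r. \<Sum>j=1..23. \<Sum>i=1..<j. ?L i j r * ?d r) =
        (\<Sum>j=1..23. integral {0..?R} (\<lambda>r. \<Sum>i=1..<j. ?L i j r * ?d r))"
      using cL by (intro integral_sum integrable_continuous_real continuous_on_sum) auto
    also have "\<dots> = (\<Sum>j=1..23. \<Sum>i=1..<j. integral {0..?R} (\<lambda>r. ?L i j r * ?d r))"
      using cL by (intro sum.cong refl integral_sum integrable_continuous_real) auto
    also have "\<dots> = (\<Sum>j=1..23. \<Sum>i=1..<j. 4 * omega_4 (angle (w i) (w j)))"
      by (intro sum.cong refl om) auto
    also have "\<dots> = 4 * pair_sum omega_4 w" by (simp add: pair_sum_def sum_distrib_left)
    finally show ?thesis .
  qed
  have "integral {0..?R} (\<lambda>r. measure sphere_measure (uncovered ?W r) * ?d r) =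
      integral {0..?R} (\<lambda>r. (2 * pi\<^sup>2 - 23 * C r) * ?d r + (\<Sum>j=1..23. \<Sum>i=1..<j. ?L i j r * ?d r) - (\<Sum>k=1..23. \<Sum>j=1..<k. \<Sum>i=1..<j. ?T i j k r * ?d r))"
  proof (rule integral_spike[of "{?R}"])
    fix r assume "r \<in> {0..?R} - {?R}"
    then have "measure sphere_measure (uncovered ?W r) =
      (2 * pi\<^sup>2 - 23 * C r) + (\<Sum>j=1..23. \<Sum>i=1..<j. ?L i j r) -
      (\<Sum>k=1..23. \<Sum>j=1..<k. \<Sum>i=1..<j. ?T i j k r)" by (intro unc) auto
    then show "(2 * pi\<^sup>2 - 23 * C r) * ?d r + (\<Sum>j=1..23. \<Sum>i=1..<j. ?L i j r * ?d r) - (\<Sum>k=1..23. \<Sum>j=1..<k. \<Sum>i=1..<j. ?T i j k r * ?d r) =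
        measure sphere_measure (uncovered ?W r) * ?d r"
      by (simp only: distrib_right left_diff_distrib[of "_ + _"] sum_distrib_right)
  qed simp
  also have "\<dots> = integral {0..?R} (\<lambda>r. (2 * pi\<^sup>2 - 23 * C r) * ?d r + (\<Sum>j=1..23. \<Sum>i=1..<j. ?L i j r * ?d r)) -
      integral {0..?R} (\<lambda>r. (\<Sum>k=1..23. \<Sum>j=1..<k. \<Sum>i=1..<j. ?T i j k r * ?d r))"
    using c1 cL cT by (intro integral_diff integrable_continuous_real continuous_on_sum continuous_on_add) auto
  also have "integral {0..?R} (\<lambda>r. (\<Sum>k=1..23. \<Sum>j=1..<k. \<Sum>i=1..<j. ?T i j k r * ?d r)) =
      (\<Sum>k=1..23. integral {0..?R} (\<lambda>r. \<Sum>j=1..<k. \<Sum>i=1..<j. ?T i j k r * ?d r))"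
    using cT by (intro integral_sum integrable_continuous_real continuous_on_sum) auto
  also have "\<dots> = (\<Sum>k=1..23. \<Sum>j=1..<k. integral {0..?R} (\<lambda>r. \<Sum>i=1..<j. ?T i j k r * ?d r))"
    using cT by (intro sum.cong refl integral_sum integrable_continuous_real continuous_on_sum) auto
  also have "\<dots> = (\<Sum>k=1..23. \<Sum>j=1..<k. \<Sum>i=1..<j. integral {0..?R} (\<lambda>r. ?T i j k r * ?d r))"
    using cT by (intro sum.cong refl integral_sum integrable_continuous_real) auto
  also have "\<dots> = (\<Sum>k=1..23. \<Sum>j=1..<k. \<Sum>i=1..<j.
      4 * omega_3 (angle (w i) (w j)) (angle (w i) (w k)) (angle (w j) (w k)))"
    by (intro sum.cong refl om3) auto
  also have "\<dots> = 4 * triple_sum omega_3 w" by (simp add: triple_sum_def sum_distrib_left)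
  also have "integral {0..?R} (\<lambda>r. (2 * pi\<^sup>2 - 23 * C r) * ?d r + (\<Sum>j=1..23. \<Sum>i=1..<j. ?L i j r * ?d r)) =
      integral {0..?R} (\<lambda>r. (2 * pi\<^sup>2 - 23 * C r) * ?d r) +
      integral {0..?R} (\<lambda>r. (\<Sum>j=1..23. \<Sum>i=1..<j. ?L i j r * ?d r))"
    using c1 cL by (intro integral_add integrable_continuous_real continuous_on_sum) auto
  also have "integral {0..?R} (\<lambda>r. \<Sum>j=1..23. \<Sum>i=1..<j. ?L i j r * ?d r) = 4 * pair_sum omega_4 w"
    by (rule pairs)
  also have "integral {0..?R} (\<lambda>r. (2 * pi\<^sup>2 - 23 * C r) * ?d r) = sec4_integral ?R (\<lambda>r. 2 * pi\<^sup>2 - 23 * C r)"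
    by (simp add: sec4_integral_eq[OF R])
  finally have "truncated_vol ?W ?R = A_4 + pair_sum omega_4 w - triple_sum omega_3 w"
    unfolding truncated_vol_eq[OF W R] A_4_def by (simp add: algebra_simps)
  then show ?thesis unfolding truncated_vol_def sec .
qed



theorem theorem7p69:
  shows
    "\<bar>(8 - A_star) - 0.092855570\<bar> < 5 / 10 ^ 10 \<and>
     \<bar>(8 - A_4) - 0.352442\<bar> < 5 / 10 ^ 7 \<and>
     (\<forall>w. config23 w \<longrightarrow>
        (pair_sum omega w \<ge> 8 - A_star \<longleftrightarrow>
         vol (cell (w ` {1..23}) \<inter> cball 0 (sqrt (3 / 2))) \<ge> 8)) \<and>
     ((\<forall>w. config23 w \<longrightarrow> pair_sum omega w \<ge> 8 - A_star) \<longrightarrow>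
        (\<forall>w. config23 w \<longrightarrow>
           vol (cell (w ` {1..23})) \<ge> 8 \<and>
           (pair_sum omega w > 8 - A_star \<longrightarrow> vol (cell (w ` {1..23})) > 8)) \<and>
        (\<forall>w. config23 w \<longrightarrow> vol (cell (w ` {1..23})) > 8)) \<and>
     ((\<forall>w. config23 w \<longrightarrow> pair_sum omega_4 w - triple_sum omega_3 w \<ge> 8 - A_4) \<longrightarrow>
        (\<forall>w. config23 w \<longrightarrow> vol (cell (w ` {1..23})) > 8))"
proof -
  have less: "vol (cell (w ` {1..23}) \<inter> cball 0 R) < vol (cell (w ` {1..23}))"
    if "config23 w" "R \<le> sqrt (8 / 5)" for w R
    using that by (intro vol_truncated_less) (simp_all add: config23_def)
  \<comment> \<open>The truncated volume alone is already at least 8, and the part of the cell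
    outside the ball adds a positive amount. Hence the non-strict inequality gives the strict
    conclusion, from which the weaker clauses follow.\<close>
  have double: "8 < vol (cell (w ` {1..23}))" if "config23 w" "pair_sum omega w \<ge> 8 - A_star" for w
    using config_decomposition_double[OF that(1)] less[OF that(1), of "sqrt (3 / 2)"] that(2) by simp
  have triple: "8 < vol (cell (w ` {1..23}))"
    if "config23 w" "pair_sum omega_4 w - triple_sum omega_3 w \<ge> 8 - A_4" for w
    using config_decomposition_triple[OF that(1)] less[OF that(1), of "sqrt (8 / 5)"] that(2) by simp
  have iff: "pair_sum omega w \<ge> 8 - A_star \<longleftrightarrow>
      vol (cell (w ` {1..23}) \<inter> cball 0 (sqrt (3 / 2))) \<ge> 8" if "config23 w" for w
    using config_decomposition_double[OF that] by linarith
  show ?thesis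
    by (intro conjI allI impI A_star_bound A_4_bound iff) (blast intro: double triple less_imp_le[OF double])+
qed

end
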